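(* Let $(\mathcal{A},\Omega)$ be a commutative (i.e. $\mathcal{A}$ is commutative) and downwards closed abstract $O^*$-algebra with sufficiently many Stieltjes states. Then $\mathcal{S}_{\mathrm{p}}(\mathcal{A},\Omega) = \mathcal{M}(\mathcal{A},\Omega)$, i.e. the set of pure states of $(\mathcal{A},\Omega)$ coincides with the set of characters of $(\mathcal{A},\Omega)$.
   Context: All $^*$-algebras are associative, unital (unit $\mathbb{1}$) and over $\mathbb{C}$; $\mathbb{N}=\{1,2,\dots\}$. For a $^*$-algebra $\mathcal{A}$, $\mathcal{A}_{\mathrm H}:=\{a\in\mathcal{A} : a=a^*\}$. A quasi-ordered $^*$-algebra is a $^*$-algebra $\mathcal{A}$ with a reflexive and transitive relation $\lesssim$ on $\mathcal{A}_{\mathrm H}$ such that for all $a,b\in\mathcal{A}_{\mathrm H}$ with $a\lesssim b$, all $c\in\mathcal{A}_{\mathrm H}$, $d\in\mathcal{A}$: $a+c\lesssim b+c$, $d^*ad\lesssim d^*bd$, and $0\lesssim\mathbb{1}$. Put $\mathcal{A}^+_{\mathrm H}:=\{a\in\mathcal{A}_{\mathrm H} : 0\lesssim a\}$. $\mathcal{A}^*$ is the space of all linear functionals $\mathcal{A}\to\mathbb{C}$, with dual pairing $\langle\omega,a\rangle$. For $\omega\in\mathcal{A}^*$ and $a,b,c\in\mathcal{A}$: $\langle\omega^*,a\rangle:=\overline{\langle\omega,a^*\rangle}$; $\langle b\cdot\omega\cdot c,a\rangle:=\langle\omega,cab\rangle$ (an $\mathcal{A}$-bimodule structure); $a\triangleright\omega:=a\cdot\omega\cdot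 a^*$, i.e. $\langle a\triangleright\omega,x\rangle=\langle\omega,a^*xa\rangle$. Put $\mathcal{A}^*_{\mathrm H}:=\{\omega : \omega^*=\omega\}$, partially ordered by $\omega\le\rho$ iff $\langle\omega,a\rangle\le\langle\rho,a\rangle$ for all $a\in\mathcal{A}^+_{\mathrm H}$, and $\mathcal{A}^{*,+}_{\mathrm H}:=\{\omega\in\mathcal{A}^*_{\mathrm H} : \omega\ge0\}$. An abstract $O^*$-algebra is a pair $(\mathcal{A},\Omega)$ of a quasi-ordered $^*$-algebra $\mathcal{A}$ and a linear subspace and $\mathcal{A}$-subbimodule $\Omega\subseteq\mathcal{A}^*$ stable under $\omega\mapsto\omega^*$ such that, with $\Omega_{\mathrm H}:=\Omega\cap\mathcal{A}^*_{\mathrm H}$ and $\Omega^+_{\mathrm H}:=\Omega\cap\mathcal{A}^{*,+}_{\mathrm H}$, $\Omega$ is the linear span of $\Omega^+_{\mathrm H}$ and $\mathcal{A}^+_{\mathrm H}=\{a\in\mathcal{A}_{\mathrm H} : \langle\omega,a\rangle\ge0\text{ for all }\omega\in\Omega^+_{\mathrm H}\}$. States: $\mathcal{S}(\mathcal{A},\Omega):=\{\omega\in\Omega^+_{\mathrm H} : \langle\omega,\mathbb{1}\rangle=1\}$; pure states: $\mathcal{S}_{\mathrm p}(\mathcal{A},\Omega)$ is the set of extreme points of the convex set $\mathcal{S}(\mathcal{A},\Omega)$; characters: $\mathcal{M}(\mathcal{A},\Omega)$ is the set of $\omega\in\mathcal{S}(\mathcal{A},\Omega)$ with $\langle\omega,ab\rangle=\langle\omega,a\rangle\langle\omega,b\rangle$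 for all $a,b\in\mathcal{A}$. $(\mathcal{A},\Omega)$ is downwards closed if every $\rho\in\mathcal{A}^{*,+}_{\mathrm H}$ for which there exists $\omega\in\Omega^+_{\mathrm H}$ with $\omega-\rho\in\mathcal{A}^{*,+}_{\mathrm H}$ is an element of $\Omega^+_{\mathrm H}$. An element $q\in\mathcal{A}^+_{\mathrm H}$ is coercive if $q\gtrsim\epsilon\mathbb{1}$ for some $\epsilon>0$. A non-empty set $Q\subseteq\mathcal{A}_{\mathrm H}$ of pairwise commuting elements is dominant if for all $q,r\in Q$ and $\lambda\in[1,\infty)$: $q^2$ is coercive, $\lambda q\in Q$ and $qr\in Q$. For dominant $Q$, $Q^\downarrow:=\{a\in\mathcal{A} : \forall q\in Q\ \exists r,s\in Q:\ a^*q^2a\lesssim r^2\text{ and }aq^2a^*\lesssim s^2\}$, which is a unital $^*$-subalgebra of $\mathcal{A}$ with the inherited order; $(Q^\downarrow)^+_{\mathrm H}:=Q^\downarrow\cap\mathcal{A}^+_{\mathrm H}$. If $Q'\subseteq\mathcal{A}^+_{\mathrm H}$ is a non-empty set of coercive pairwise commuting elements, then $Q:=\{\lambda q_1'\cdots q_N' : \lambda\in[1,\infty),\,N\in\mathbb{N},\,q_1',\dots,q_N'\in Q'\}$ is dominant ("the dominant set constructed out of $Q'$"). For $a\in\mathcal{A}^+_{\mathrm H}$, $\omega\in\mathcal{S}(\mathcal{A},\Omega)$ is a Stieltjes state for $a$ if for all $b\in\mathcal{A}$ with $\langle\omega,b^*b\rangle=1$: $\langle b\triangleright\omega,a\rangle=0$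 or $\sum_{n=1}^\infty\langle b\triangleright\omega,a^n\rangle^{-1/(2n)}=\infty$ (if $\langle b\triangleright\omega,a\rangle\neq0$, all $\langle b\triangleright\omega,a^n\rangle$ are $>0$). The strong topology on $\mathcal{A}$ is the locally convex topology defined by the seminorms $a\mapsto\sqrt{\langle\omega,a^*a\rangle}$, $\omega\in\Omega^+_{\mathrm H}$. $(\mathcal{A},\Omega)$ has sufficiently many Stieltjes states if there is a non-empty set $Q'\subseteq\mathcal{A}^+_{\mathrm H}$ of coercive and pairwise commuting elements such that every $\omega\in\mathcal{S}(\mathcal{A},\Omega)$ is a Stieltjes state for every $q'\in Q'$, and such that $(Q^\downarrow)^+_{\mathrm H}$ is strongly dense in $\mathcal{A}^+_{\mathrm H}$, where $Q$ is the dominant set constructed out of $Q'$. *)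

theory Defs
  imports
    "HOL-Analysis.Analysis"
    "HOL-Library.Function_Algebras"
    "HOL-Library.Complex_Order"
begin

section \<open>Unital complex *-algebras\<close>

text \<open>
  The class is built on \<^class>\<open>ring\<close> and \<^class>\<open>monoid_mult\<close> rather than on \<^class>\<open>ring_1\<close> because
  the latter demands \<open>0 \<noteq> 1\<close>, which would exclude the zero algebra.
\<close>

class complex_star_algebra = ring + monoid_mult +
  fixes scaleC :: "complex \<Rightarrow> 'a \<Rightarrow> 'a"  (infixr \<open>*\<^sub>C\<close> 75)
    and star :: "'a \<Rightarrow> 'a"  (\<open>(_\<^sup>\<star>)\<close> [1000] 999)
  assumes scaleC_add_right: "z *\<^sub>C (a + b) = z *\<^sub>C a + z *\<^sub>C b"
    and scaleC_add_left: "(z + w) *\<^sub>C a = z *\<^sub>C a + w *\<^sub>C a"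
    and scaleC_scaleC: "z *\<^sub>C w *\<^sub>C a = (z * w) *\<^sub>C a"
    and scaleC_one: "1 *\<^sub>C a = a"
    and mult_scaleC_left: "(z *\<^sub>C a) * b = z *\<^sub>C (a * b)"
    and mult_scaleC_right: "a * (z *\<^sub>C b) = z *\<^sub>C (a * b)"
    and star_star: "(a\<^sup>\<star>)\<^sup>\<star> = a"
    and star_add: "(a + b)\<^sup>\<star> = a\<^sup>\<star> + b\<^sup>\<star>"
    and star_scaleC: "(z *\<^sub>C a)\<^sup>\<star> = cnj z *\<^sub>C a\<^sup>\<star>"
    and star_mult: "(a * b)\<^sup>\<star> = b\<^sup>\<star> * a\<^sup>\<star>"

lemma vector_space_scaleC:
  "vector_space (scaleC :: complex \<Rightarrow> 'a \<Rightarrow> 'a::complex_star_algebra)"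
  by unfold_locales (simp_all add: scaleC_add_right scaleC_add_left scaleC_scaleC scaleC_one)

definition hermitian :: "'a::complex_star_algebra set" where
  "hermitian = {a. a\<^sup>\<star> = a}"

text \<open>The quasi-order lives on the hermitian elements only.\<close>

locale quasi_ordered_star_algebra =
  fixes le :: "'a::complex_star_algebra \<Rightarrow> 'a \<Rightarrow> bool"  (infix \<open>\<sqsubseteq>\<close> 50)
  assumes le_hermitian: "a \<sqsubseteq> b \<Longrightarrow> a \<in> hermitian \<and> b \<in> hermitian"
    and le_refl: "a \<in> hermitian \<Longrightarrow> a \<sqsubseteq> a"
    and le_trans: "a \<sqsubseteq> b \<Longrightarrow> b \<sqsubseteq> c \<Longrightarrow> a \<sqsubseteq> c"
    and le_add: "a \<sqsubseteq> b \<Longrightarrow> c \<in> hermitian \<Longrightarrow> a + c \<sqsubseteq> b + c"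
    and le_conj: "a \<sqsubseteq> b \<Longrightarrow> d\<^sup>\<star> * a * d \<sqsubseteq> d\<^sup>\<star> * b * d"
    and zero_le_one: "0 \<sqsubseteq> 1"

definition pos_elems ::
    "('a::complex_star_algebra \<Rightarrow> 'a \<Rightarrow> bool) \<Rightarrow> 'a set" where
  "pos_elems le = {a \<in> hermitian. le 0 a}"


section \<open>Linear functionals\<close>

definition scale_fun :: "complex \<Rightarrow> ('a \<Rightarrow> complex) \<Rightarrow> 'a \<Rightarrow> complex" where
  "scale_fun z \<omega> = (\<lambda>a. z * \<omega> a)"

lemma vector_space_scale_fun: "vector_space scale_fun"
  by unfold_locales (simp_all add: scale_fun_def fun_eq_iff algebra_simps)

text \<open>Pointwise real scaling on functions, so that \<^const>\<open>extreme_point_of\<close> applies to functionals.\<close>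

instantiation "fun" :: (type, real_vector) real_vector
begin

definition scaleR_fun :: "real \<Rightarrow> ('a \<Rightarrow> 'b) \<Rightarrow> 'a \<Rightarrow> 'b" where
  "scaleR_fun r f = (\<lambda>x. r *\<^sub>R f x)"

instance
  by standard (simp_all add: scaleR_fun_def fun_eq_iff scaleR_add_right scaleR_add_left)

end

definition dual :: "('a::complex_star_algebra \<Rightarrow> complex) set" where
  "dual = {\<omega>. Vector_Spaces.linear scaleC (*) \<omega>}"

definition dual_star :: "('a::complex_star_algebra \<Rightarrow> complex) \<Rightarrow> 'a \<Rightarrow> complex" where
  "dual_star \<omega> = (\<lambda>a. cnj (\<omega> (a\<^sup>\<star>)))"

text \<open>\<open>biact b \<omega> c\<close> is the functional \<open>b \<cdot> \<omega> \<cdot> c\<close>.\<close>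

definition biact ::
    "'a \<Rightarrow> ('a::complex_star_algebra \<Rightarrow> complex) \<Rightarrow> 'a \<Rightarrow> 'a \<Rightarrow> complex" where
  "biact b \<omega> c = (\<lambda>a. \<omega> (c * a * b))"

definition conj_act ::
    "'a \<Rightarrow> ('a::complex_star_algebra \<Rightarrow> complex) \<Rightarrow> 'a \<Rightarrow> complex"  (infixr \<open>\<triangleright>\<close> 75) where
  "a \<triangleright> \<omega> = biact a \<omega> (a\<^sup>\<star>)"

definition dual_hermitian :: "('a::complex_star_algebra \<Rightarrow> complex) set" where
  "dual_hermitian = {\<omega> \<in> dual. dual_star \<omega> = \<omega>}"

text \<open>
  The inequality on the right is the order of \<^theory>\<open>HOL-Library.Complex_Order\<close>; hermitian
  functionals take real values on hermitian elements. \<open>dual_le\<close> is not the pointwise order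
  that \<open>\<le>\<close> denotes on functions.
\<close>

definition dual_le ::
    "('a::complex_star_algebra \<Rightarrow> 'a \<Rightarrow> bool) \<Rightarrow> ('a \<Rightarrow> complex) \<Rightarrow> ('a \<Rightarrow> complex) \<Rightarrow> bool" where
  "dual_le le \<omega> \<rho> \<longleftrightarrow> (\<forall>a \<in> pos_elems le. \<omega> a \<le> \<rho> a)"

definition dual_pos ::
    "('a::complex_star_algebra \<Rightarrow> 'a \<Rightarrow> bool) \<Rightarrow> ('a \<Rightarrow> complex) set" where
  "dual_pos le = {\<omega> \<in> dual_hermitian. dual_le le 0 \<omega>}"


section \<open>Abstract O*-algebras\<close>

locale abstract_Ostar_algebra = quasi_ordered_star_algebra le
  for le :: "'a::complex_star_algebra \<Rightarrow> 'a \<Rightarrow> bool" +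
  fixes \<Omega> :: "('a \<Rightarrow> complex) set"
  assumes Omega_dual: "\<Omega> \<subseteq> dual"
    and Omega_subspace: "module.subspace scale_fun \<Omega>"
    and Omega_biact: "\<omega> \<in> \<Omega> \<Longrightarrow> biact b \<omega> c \<in> \<Omega>"
    and Omega_star: "\<omega> \<in> \<Omega> \<Longrightarrow> dual_star \<omega> \<in> \<Omega>"
    and Omega_span: "\<Omega> = module.span scale_fun (\<Omega> \<inter> dual_pos le)"
    and pos_elems_eq:
      "pos_elems le = {a \<in> hermitian. \<forall>\<omega> \<in> \<Omega> \<inter> dual_pos le. 0 \<le> \<omega> a}"

definition states ::
    "('a::complex_star_algebra \<Rightarrow> 'a \<Rightarrow> bool) \<Rightarrow> ('a \<Rightarrow> complex) set \<Rightarrow> ('a \<Rightarrow> complex) set" where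
  "states le \<Omega> = {\<omega> \<in> \<Omega> \<inter> dual_pos le. \<omega> 1 = 1}"

definition pure_states ::
    "('a::complex_star_algebra \<Rightarrow> 'a \<Rightarrow> bool) \<Rightarrow> ('a \<Rightarrow> complex) set \<Rightarrow> ('a \<Rightarrow> complex) set" where
  "pure_states le \<Omega> = {\<omega>. \<omega> extreme_point_of states le \<Omega>}"

definition characters ::
    "('a::complex_star_algebra \<Rightarrow> 'a \<Rightarrow> bool) \<Rightarrow> ('a \<Rightarrow> complex) set \<Rightarrow> ('a \<Rightarrow> complex) set" where
  "characters le \<Omega> = {\<omega> \<in> states le \<Omega>. \<forall>a b. \<omega> (a * b) = \<omega> a * \<omega> b}"

definition downwards_closed ::
    "('a::complex_star_algebra \<Rightarrow> 'a \<Rightarrow> bool) \<Rightarrow> ('a \<Rightarrow> complex) set \<Rightarrow> bool" where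
  "downwards_closed le \<Omega> \<longleftrightarrow>
     (\<forall>\<rho> \<in> dual_pos le.
        (\<exists>\<omega> \<in> \<Omega> \<inter> dual_pos le. \<omega> - \<rho> \<in> dual_pos le) \<longrightarrow> \<rho> \<in> \<Omega> \<inter> dual_pos le)"


section \<open>Stieltjes states\<close>

definition coercive ::
    "('a::complex_star_algebra \<Rightarrow> 'a \<Rightarrow> bool) \<Rightarrow> 'a \<Rightarrow> bool" where
  "coercive le q \<longleftrightarrow>
     q \<in> pos_elems le \<and> (\<exists>\<epsilon>::real. \<epsilon> > 0 \<and> le (complex_of_real \<epsilon> *\<^sub>C 1) q)"

definition constructed_dominant_set :: "'a::complex_star_algebra set \<Rightarrow> 'a set" where
  "constructed_dominant_set Q' =
     {complex_of_real r *\<^sub>C prod_list qs | r qs. 1 \<le> r \<and> qs \<noteq> [] \<and> set qs \<subseteq> Q'}"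

text \<open>The *-subalgebra \<open>Q\<^sup>\<down>\<close>.\<close>

definition down_algebra ::
    "('a::complex_star_algebra \<Rightarrow> 'a \<Rightarrow> bool) \<Rightarrow> 'a set \<Rightarrow> 'a set" where
  "down_algebra le Q =
     {a. \<forall>q \<in> Q. \<exists>r \<in> Q. \<exists>s \<in> Q.
        le (a\<^sup>\<star> * q ^ 2 * a) (r ^ 2) \<and> le (a * q ^ 2 * a\<^sup>\<star>) (s ^ 2)}"

text \<open>
  The series is an \<^typ>\<open>ennreal\<close> sum, shifted so that its \<open>n\<close>-th term carries the exponent
  \<open>Suc n\<close>. All moments are positive when the first one is non-zero, so the convention
  \<open>0 powr x = 0\<close> plays no role.
\<close>

definition stieltjes_state ::
    "('a::complex_star_algebra \<Rightarrow> 'a \<Rightarrow> bool) \<Rightarrow> ('a \<Rightarrow> complex) set \<Rightarrow> 'a \<Rightarrow>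
      ('a \<Rightarrow> complex) \<Rightarrow> bool" where
  "stieltjes_state le \<Omega> a \<omega> \<longleftrightarrow>
     \<omega> \<in> states le \<Omega> \<and>
     (\<forall>b. \<omega> (b\<^sup>\<star> * b) = 1 \<longrightarrow>
        (b \<triangleright> \<omega>) a = 0 \<or>
        (\<Sum>n. ennreal (Re ((b \<triangleright> \<omega>) (a ^ Suc n)) powr (- 1 / (2 * real (Suc n))))) = \<infinity>)"

definition strong_seminorm ::
    "('a::complex_star_algebra \<Rightarrow> complex) \<Rightarrow> 'a \<Rightarrow> real" where
  "strong_seminorm \<omega> a = sqrt (Re (\<omega> (a\<^sup>\<star> * a)))"

text \<open>The open balls of the seminorms, around arbitrary centres, form a subbase.\<close>

definition strong_topology ::
    "('a::complex_star_algebra \<Rightarrow> 'a \<Rightarrow> bool) \<Rightarrow> ('a \<Rightarrow> complex) set \<Rightarrow> 'a topology" where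
  "strong_topology le \<Omega> = topology_generated_by
     {{y. strong_seminorm \<omega> (y - x) < e} | \<omega> x e. \<omega> \<in> \<Omega> \<inter> dual_pos le \<and> e > 0}"

text \<open>
  Density is an inclusion in a closure, since
  \<open>down_algebra le Q \<inter> pos_elems le\<close> is contained in \<open>pos_elems le\<close>.
\<close>

definition sufficiently_many_stieltjes_states ::
    "('a::complex_star_algebra \<Rightarrow> 'a \<Rightarrow> bool) \<Rightarrow> ('a \<Rightarrow> complex) set \<Rightarrow> bool" where
  "sufficiently_many_stieltjes_states le \<Omega> \<longleftrightarrow>
     (\<exists>Q'. Q' \<noteq> {} \<and> Q' \<subseteq> pos_elems le \<and>
        (\<forall>q \<in> Q'. coercive le q) \<and>
        (\<forall>q \<in> Q'. \<forall>r \<in> Q'. q * r = r * q) \<and>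
        (\<forall>\<omega> \<in> states le \<Omega>. \<forall>q \<in> Q'. stieltjes_state le \<Omega> q \<omega>) \<and>
        pos_elems le \<subseteq>
          strong_topology le \<Omega> closure_of
            (down_algebra le (constructed_dominant_set Q') \<inter> pos_elems le))"

end

theory Submission
  imports Defs "HOL-Computational_Algebra.Polynomial"
begin

text \<open>
  That characters are pure is a variance argument valid in every such algebra. For the converse let
  \<open>\<omega>\<close> be a pure state. If \<open>a\<close> is positive, one would like to say that \<open>x \<mapsto> \<omega> (a * x)\<close> is a positive
  functional dominated by a multiple of \<open>\<omega>\<close>, hence a multiple of \<open>\<omega>\<close> by purity, which is the
  identity \<open>\<omega> (a * x) = \<omega> a * \<omega> x\<close>. Two things stand in the way: products of positive elements need
  not be positive, and \<open>a\<close> need not be bounded. Both are overcome by division by elements of the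
  dominant set, and this is what the Stieltjes condition makes possible.

  The Stieltjes condition yields that for \<open>q \<in> Q'\<close> and every positive functional \<open>\<omega> \<in> \<Omega>\<close> there are
  elements \<open>c\<close>, polynomials in \<open>q\<close>, such that \<open>q * c\<close> is arbitrarily close to \<open>1\<close> in the seminorm
  of \<open>\<omega>\<close> (\<open>stieltjes_dense_range\<close>). This is a statement about one moment sequence on a half-line
  \<open>[\<epsilon>, \<infinity>)\<close>, and is proved with orthogonal polynomials and Carleman's inequality
  (\<open>carleman_imp_one_in_closure\<close>). The property passes to products, hence to the dominant set.

  Now let \<open>a\<close> be a positive element of \<open>Q\<^sup>\<down>\<close>. Then \<open>a \<le> r\<^sup>2\<close> for some \<open>r\<close> in the dominant set. The
  quotient \<open>a / r\<^sup>2\<close> is not an element of the algebra, but the approximations of \<open>1\<close> by multiples of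
  powers of \<open>r\<close> allow one to compute with it, and F. Riesz' decomposition of a positive contraction
  into squares shows that \<open>\<omega> (a * x) \<ge> 0\<close> for positive \<open>x\<close> (\<open>mult_nonneg_of_square_bound\<close>). By strong
  density, products of arbitrary positive elements are positive (\<open>Pos_mult\<close>).

  Finally, for \<open>q \<in> Q'\<close> the functional \<open>x \<mapsto> \<omega> (q\<inverse> * x)\<close> is defined as a limit of \<open>\<omega> (c * x)\<close>; it is
  positive, dominated by a multiple of \<open>\<omega>\<close>, and belongs to \<open>\<Omega>\<close> by downwards closedness
  (\<open>inverse_functional\<close>). Purity makes it a multiple of \<open>\<omega>\<close>, so \<open>\<omega>\<close> is multiplicative at \<open>q\<close>, and
  then at the whole dominant set. For a positive \<open>a \<in> Q\<^sup>\<down>\<close> with \<open>a \<le> r\<^sup>2\<close> the functional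
  \<open>x \<mapsto> \<omega> (a * x)\<close> is then dominated by \<open>\<omega>(r)\<^sup>2 \<omega>\<close>, so \<open>\<omega>\<close> is multiplicative at \<open>a\<close>. Density and
  linearity extend this to all of the algebra.
\<close>

section \<open>Carleman's inequality\<close>

text \<open>
  Polya's proof: the arithmetic-geometric mean inequality is applied not to the \<open>w j\<close> but to
  \<open>c j * w j\<close>, where the weights have the products \<open>c 0 * \<dots> * c n = (n + 2) ^ (n + 1)\<close>. The
  arithmetic means then telescope when they are summed over \<open>n\<close>, and what is left of the weight
  of \<open>w j\<close> is \<open>(1 + 1 / (j + 1)) ^ (j + 1)\<close>, which is below \<open>exp 1\<close>.
\<close>

lemma carleman_inequality:
  fixes w :: "nat \<Rightarrow> real"
  assumes w: "\<And>j. 0 \<le> w j"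
  shows "(\<Sum>n<N. (\<Prod>j\<le>n. w j) powr (1 / real (Suc n))) \<le> exp 1 * (\<Sum>j<N. w j)"
proof -
  define c where "c j = (real j + 2) ^ (j + 1) / (real j + 1) ^ j" for j
  have c_pos: "c j > 0" for j
    by (simp add: c_def)
  have prod_c: "(\<Prod>j\<le>n. c j) = (real n + 2) ^ (n + 1)" for n
  proof (induction n)
    case (Suc n)
    have "(real n + 2) ^ (n + 1) * c (Suc n) = (real (Suc n) + 2) ^ (Suc n + 1)"
      by (simp add: c_def add.commute add.left_commute)
    with Suc show ?case
      by (simp add: mult.commute)
  qed (simp add: c_def)
  have c_le: "c j / (real j + 1) \<le> exp 1" for j
  proof -
    have "c j / (real j + 1) = (1 + 1 / real (Suc j)) ^ Suc j"
    proof -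
      have "1 + 1 / real (Suc j) = (real j + 2) / (real j + 1)"
        by (simp add: field_simps)
      then show ?thesis
        by (simp add: c_def power_divide)
    qed
    also have "\<dots> \<le> exp 1"
      using exp_ge_one_plus_x_over_n_power_n[of "Suc j" 1] by simp
    finally show ?thesis .
  qed
  have geo: "(\<Prod>j\<le>n. w j) powr (1 / real (Suc n))
      \<le> (\<Sum>j\<le>n. c j * w j * (1 / (real n + 1) - 1 / (real n + 2)))" for n
  proof -
    have "((\<Prod>j\<le>n. w j) powr (1 / real (Suc n))) * (real n + 2)
        = (\<Prod>j\<le>n. c j * w j) powr (1 / real (Suc n))"
    proof -
      have "((real n + 2) ^ (n + 1)) powr (1 / real (Suc n)) = real n + 2"
        by (simp add: powr_realpow[symmetric] powr_powr del: power_Suc)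
      then show ?thesis
        by (simp add: prod.distrib prod_c powr_mult prod_nonneg w mult.commute del: power_Suc)
    qed
    also have "\<dots> \<le> (\<Sum>j\<le>n. c j * w j / real (Suc n))"
      using arith_geom_mean[of "{..n}" "\<lambda>j. c j * w j"] w c_pos
      by (simp add: less_imp_le)
    also have "\<dots> = (\<Sum>j\<le>n. c j * w j * (1 / (real n + 1) - 1 / (real n + 2))) * (real n + 2)"
    proof -
      have "1 / (real n + 1) - 1 / (real n + 2) = 1 / (real (Suc n) * (real n + 2))"
        by (simp add: diff_frac_eq add_nonneg_eq_0_iff)
      then have "1 / real (Suc n) = (1 / (real n + 1) - 1 / (real n + 2)) * (real n + 2)"
        by (simp del: of_nat_Suc)
      then show ?thesis
        by (simp only: sum_distrib_right divide_inverse mult.assoc mult_1_left)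
    qed
    finally show ?thesis
      by simp
  qed
  have "(\<Sum>n<N. (\<Prod>j\<le>n. w j) powr (1 / real (Suc n)))
      \<le> (\<Sum>j<N. c j * w j * (1 / (real j + 1) - 1 / (real N + 1)))"
  proof (induction N)
    case (Suc N)
    have "(\<Sum>n<Suc N. (\<Prod>j\<le>n. w j) powr (1 / real (Suc n)))
        \<le> (\<Sum>j<N. c j * w j * (1 / (real j + 1) - 1 / (real N + 1)))
          + (\<Sum>j<Suc N. c j * w j * (1 / (real N + 1) - 1 / (real N + 2)))"
      using add_mono[OF Suc geo[of N]] by (simp only: sum.lessThan_Suc lessThan_Suc_atMost[symmetric])
    also have "\<dots> = (\<Sum>j<Suc N. c j * w j * (1 / (real j + 1) - 1 / (real N + 1)))
          + (\<Sum>j<Suc N. c j * w j * (1 / (real N + 1) - 1 / (real N + 2)))"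
      by simp
    also have "\<dots> = (\<Sum>j<Suc N. c j * w j * (1 / (real j + 1) - 1 / (real (Suc N) + 1)))"
      unfolding sum.distrib[symmetric] by (rule sum.cong) (auto simp: algebra_simps)
    finally show ?case .
  qed simp
  also have "\<dots> \<le> (\<Sum>j<N. exp 1 * w j)"
  proof (rule sum_mono)
    fix j
    have "c j * w j * (1 / (real j + 1) - 1 / (real N + 1)) \<le> c j * w j * (1 / (real j + 1))"
      using c_pos[of j] w[of j] by (intro mult_left_mono) auto
    also have "\<dots> = c j / (real j + 1) * w j"
      by simp
    also have "\<dots> \<le> exp 1 * w j"
      by (intro mult_right_mono c_le w)
    finally show "c j * w j * (1 / (real j + 1) - 1 / (real N + 1)) \<le> exp 1 * w j" .
  qed
  finally show ?thesis
    by (simp add: sum_distrib_left)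
qed

section \<open>The Carleman condition for coercive Stieltjes moments\<close>

text \<open>
  The moments \<open>L (X ^ n)\<close> of such a functional are those of a probability measure on the half-line
  \<open>[\<epsilon>, \<infinity>)\<close>. The aim of this section is that, under the Stieltjes form of Carleman's condition,
  \<open>1\<close> lies in the closure of the multiples of \<open>X\<close> for the seminorm \<open>sqrt (L (p\<^sup>2))\<close>. This is
  the part of determinacy of the moment problem that is needed later: it makes the inverse of a
  coercive element available as a limit of polynomials.

  The argument is the classical one with the two families of orthogonal polynomials of a
  Stieltjes problem, in the form of M. G. Krein's loaded string. If \<open>P k\<close> and \<open>R k\<close> are the monic
  orthogonal polynomials of \<open>L\<close> and of \<open>p \<mapsto> L (X * p)\<close>, the masses
  \<open>m k = P k(0)\<^sup>2 / L (P k\<^sup>2)\<close> and lengths \<open>l k = L (R k)\<^sup>2 / L (X * R k\<^sup>2)\<close> satisfy two a priori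
  bounds: the masses have a finite sum exactly if \<open>1\<close> has positive distance from the multiples of
  \<open>X\<close>, and the lengths have a sum of at most \<open>1 / \<epsilon>\<close> by coercivity. On the other hand the
  products of adjacent square roots of masses and lengths are the ratios of the norms of
  consecutive orthogonal polynomials, and those norms are dominated by the moments. Carleman's
  inequality turns this into a bound for the Carleman series.
\<close>

locale coercive_moment_functional =
  fixes L :: "real poly \<Rightarrow> real" and \<epsilon> :: real
  assumes add: "L (p + q) = L p + L q"
    and smult: "L (smult c p) = c * L p"
    and one: "L 1 = 1"
    and square: "0 \<le> L (p ^ 2)"
    and coercive: "\<epsilon> * L (p ^ 2) \<le> L ([:0, 1:] * p ^ 2)"
    and eps_pos: "0 < \<epsilon>"
begin

definition X :: "real poly" where "X = [:0, 1:]"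

lemma coercive_X: "\<epsilon> * L (p\<^sup>2) \<le> L (X * p\<^sup>2)"
  using coercive by (simp only: X_def)

lemma coeff_X_mult: "coeff (X * f) 0 = 0" "coeff (X * f) (Suc n) = coeff f n"
  by (simp_all add: X_def)

lemma poly_X [simp]: "poly X a = a"
  by (simp add: X_def)

lemma zero: "L 0 = 0"
  using smult[of 0 0] by simp

lemma diff: "L (p - q) = L p - L q"
  using add[of p "smult (- 1) q"] smult[of "- 1" q] by simp

lemma square_add: "L ((p + q)\<^sup>2) = L (p\<^sup>2) + 2 * L (p * q) + L (q\<^sup>2)"
proof -
  have "(p + q)\<^sup>2 = p\<^sup>2 + (p * q + p * q) + q\<^sup>2"
    by (simp add: power2_eq_square algebra_simps)
  then show ?thesis
    by (simp only: add mult_2)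
qed

lemma cauchy_schwarz_one: "(L p)\<^sup>2 \<le> L (p\<^sup>2)"
proof -
  have c: "L (smult (- L p) 1 * smult (- L p) 1) = (L p)\<^sup>2"
    using smult[of "(L p)\<^sup>2" 1] by (simp add: one power2_eq_square)
  have "L (p * smult (- L p) 1) = - (L p)\<^sup>2"
    using smult[of "- L p" p] by (simp add: power2_eq_square)
  with c have "L ((p + smult (- L p) 1)\<^sup>2) = L (p\<^sup>2) - (L p)\<^sup>2"
    unfolding square_add by (simp only: power2_eq_square[of "smult (- L p) 1"])
  with square[of "p + smult (- L p) 1"] show ?thesis by simp
qed

text \<open>
  The pairs \<open>(P k, R k)\<close>. Both families come from one three-term recurrence with vanishing
  diagonal: \<open>P k(y\<^sup>2)\<close> and \<open>y * R k(y\<^sup>2)\<close> are the even and odd orthogonal polynomials of the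
  symmetric measure on the line whose image under \<open>y \<mapsto> y\<^sup>2\<close> is the given one.
\<close>

primrec orth :: "nat \<Rightarrow> real poly \<times> real poly" where
  "orth 0 = (1, 1)"
| "orth (Suc k) =
    (let P = fst (orth k); R = snd (orth k);
         P' = X * R - smult (L (X * R\<^sup>2) / L (P\<^sup>2)) P
     in (P', P' - smult (L (P'\<^sup>2) / L (X * R\<^sup>2)) R))"

definition P :: "nat \<Rightarrow> real poly" where "P k = fst (orth k)"
definition R :: "nat \<Rightarrow> real poly" where "R k = snd (orth k)"
definition A :: "nat \<Rightarrow> real" where "A k = L ((P k)\<^sup>2)"
definition B :: "nat \<Rightarrow> real" where "B k = L (X * (R k)\<^sup>2)"

lemma P_0: "P 0 = 1" and R_0: "R 0 = 1"
  and P_Suc: "P (Suc k) = X * R k - smult (B k / A k) (P k)"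
  and R_Suc: "R (Suc k) = P (Suc k) - smult (A (Suc k) / B k) (R k)"
  by (simp_all add: P_def R_def A_def B_def Let_def)

text \<open>
  \<open>below k\<close> consists of the polynomials of degree less than \<open>k\<close>; unlike a condition on \<open>degree\<close>,
  the condition on the coefficients gives \<open>{0}\<close> for \<open>k = 0\<close>.
\<close>

definition below :: "nat \<Rightarrow> real poly set" where
  "below k = {f. \<forall>i\<ge>k. coeff f i = 0}"

definition monic_of :: "nat \<Rightarrow> real poly \<Rightarrow> bool" where
  "monic_of k f \<longleftrightarrow> coeff f k = 1 \<and> f \<in> below (Suc k)"

lemma below_X: "f \<in> below k \<Longrightarrow> X * f \<in> below (Suc k)"
  unfolding below_def mem_Collect_eq by (metis Suc_le_D Suc_le_mono coeff_X_mult(2))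

lemma below_mono: "f \<in> below k \<Longrightarrow> k \<le> l \<Longrightarrow> f \<in> below l"
  by (auto simp: below_def)

lemma below_add: "f \<in> below k \<Longrightarrow> g \<in> below k \<Longrightarrow> f + g \<in> below k"
  by (auto simp: below_def)

lemma below_smult: "f \<in> below k \<Longrightarrow> smult c f \<in> below k"
  by (auto simp: below_def)

lemma monic_diff: "monic_of k f \<Longrightarrow> monic_of k g \<Longrightarrow> f - g \<in> below k"
  unfolding monic_of_def below_def
  by (auto simp: Suc_le_eq) (metis diff_self le_neq_implies_less)

lemma monic_X: "monic_of k f \<Longrightarrow> monic_of (Suc k) (X * f)"
  by (auto simp: monic_of_def below_X coeff_X_mult)

lemma monic_minus: "monic_of k f \<Longrightarrow> g \<in> below k \<Longrightarrow> monic_of k (f - g)"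
  by (auto simp: monic_of_def below_def)

lemma below_Suc_decomp:
  assumes "f \<in> below (Suc k)" "monic_of k g"
  obtains c h where "f = smult c g + h" "h \<in> below k"
proof
  show "f = smult (coeff f k) g + (f - smult (coeff f k) g)" by simp
  show "f - smult (coeff f k) g \<in> below k"
  proof -
    have "coeff f i - coeff f k * coeff g i = 0" if "k \<le> i" for i
      using assms that unfolding monic_of_def below_def by (cases "i = k") auto
    then show ?thesis
      unfolding below_def mem_Collect_eq coeff_diff coeff_smult by blast
  qed
qed

lemma monic_P_R: "monic_of k (P k) \<and> monic_of k (R k)"
proof (induction k)
  case 0
  show ?case
    by (simp add: P_0 R_0 monic_of_def below_def)
next
  case (Suc k)
  then have P: "monic_of (Suc k) (P (Suc k))"
    unfolding P_Suc
    by (intro monic_minus monic_X below_smult) (auto simp: monic_of_def)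
  moreover have "monic_of (Suc k) (R (Suc k))"
    unfolding R_Suc using P Suc
    by (intro monic_minus below_smult) (auto simp: monic_of_def)
  ultimately show ?case by simp
qed

lemmas monic_P = monic_P_R[THEN conjunct1] and monic_R = monic_P_R[THEN conjunct2]

text \<open>
  The assumption \<open>gap\<close> says that \<open>1\<close> has squared distance at least \<open>d\<close> from the multiples of \<open>X\<close>:
  a polynomial with value \<open>1\<close> at \<open>0\<close> is \<open>1\<close> minus a multiple of \<open>X\<close>. The Carleman condition
  will refute it.
\<close>

context
  fixes d :: real
  assumes d_pos: "0 < d"
    and gap: "\<And>p. d * (poly p 0)\<^sup>2 \<le> L (p\<^sup>2)"
begin

text \<open>
  All five statements have to be carried through one induction: the coefficients of the recurrence
  make sense only because the norms are positive. The norm of \<open>P (Suc k)\<close> is positive by \<open>gap\<close>,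
  because its value at \<open>0\<close> is the one of \<open>P k\<close> times a negative number; the norm of \<open>R (Suc k)\<close> is
  positive by coercivity, as \<open>R (Suc k)\<close> differs from \<open>P (Suc k)\<close> by something orthogonal to the
  latter.
\<close>

lemma orthogonality:
  "poly (P k) 0 \<noteq> 0 \<and> 0 < A k \<and> 0 < B k \<and>
   (\<forall>f\<in>below k. L (P k * f) = 0) \<and> (\<forall>f\<in>below k. L (X * R k * f) = 0)"
proof (induction k)
  case 0
  have "0 < L (X * 1\<^sup>2)"
    using coercive_X[of 1] eps_pos one by simp
  moreover have "f = 0" if "f \<in> below 0" for f
    using that by (auto simp: below_def poly_eq_iff)
  ultimately show ?case
    by (metis A_def B_def P_0 R_0 mult_zero_right one one_neq_zero one_power2 poly_1 zero zero_less_one)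
next
  case (Suc k)
  then have p0: "poly (P k) 0 \<noteq> 0" and A: "0 < A k" and B: "0 < B k"
    and oP: "\<And>f. f \<in> below k \<Longrightarrow> L (P k * f) = 0"
    and oR: "\<And>f. f \<in> below k \<Longrightarrow> L (X * R k * f) = 0"
    by auto
  have oP': "L (P (Suc k) * f) = 0" if f_in: "f \<in> below (Suc k)" for f
  proof -
    obtain c g where f: "f = smult c (P k) + g" and g: "g \<in> below k"
      using f_in by (rule below_Suc_decomp[OF _ monic_P])
    have "L (X * R k * (P k - R k)) = 0"
      by (intro oR monic_diff monic_P monic_R)
    then have XRP: "L (X * R k * P k) = B k"
      by (simp add: B_def power2_eq_square right_diff_distrib diff mult.assoc)
    have "P (Suc k) * f = smult c (X * R k * P k) + X * R k * g
        - smult (B k / A k) (smult c ((P k)\<^sup>2) + P k * g)"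
      unfolding P_Suc f
      by (simp add: algebra_simps power2_eq_square smult_add_right smult_diff_right)
    then have "L (P (Suc k) * f) = c * B k + L (X * R k * g) - B k / A k * (c * A k + L (P k * g))"
      by (simp add: add diff smult XRP A_def)
    then show ?thesis
      using A g by (simp add: oP oR)
  qed
  have p0': "poly (P (Suc k)) 0 \<noteq> 0"
    using p0 A B by (simp add: P_Suc)
  have A': "0 < A (Suc k)"
    using gap[of "P (Suc k)"] d_pos p0' unfolding A_def
    by (smt (verit) mult_pos_pos zero_less_power2)
  have "A (Suc k) \<le> L ((R (Suc k))\<^sup>2)"
  proof -
    define g where "g = R (Suc k) - P (Suc k)"
    have "g \<in> below (Suc k)"
      unfolding g_def by (intro monic_diff monic_P monic_R)
    then have "L (P (Suc k) * g) = 0" by (rule oP')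
    moreover have "L ((R (Suc k))\<^sup>2) = L ((P (Suc k) + g)\<^sup>2)"
      by (simp add: g_def)
    ultimately show ?thesis
      using square[of g] by (simp add: A_def square_add)
  qed
  then have B': "0 < B (Suc k)"
    using coercive_X[of "R (Suc k)"] A' eps_pos unfolding B_def
    by (smt (verit) mult_pos_pos)
  have oR': "L (X * R (Suc k) * f) = 0" if f_in: "f \<in> below (Suc k)" for f
  proof -
    obtain c g where f: "f = smult c (R k) + g" and g: "g \<in> below k"
      using f_in by (rule below_Suc_decomp[OF _ monic_R])
    have "L (P (Suc k) * (X * R k - P (Suc k))) = 0"
      by (intro oP' monic_diff monic_P monic_X monic_R)
    then have XRP: "L (P (Suc k) * (X * R k)) = A (Suc k)"
      by (simp add: A_def power2_eq_square right_diff_distrib diff)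
    have XRf: "L (X * R k * f) = c * B k"
      using oR[OF g] unfolding f
      by (simp add: B_def power2_eq_square distrib_left add smult mult.assoc)
    have "X * R (Suc k) * f = smult c (P (Suc k) * (X * R k)) + P (Suc k) * (X * g)
        - smult (A (Suc k) / B k) (X * R k * f)"
      unfolding R_Suc f
      by (simp add: algebra_simps smult_add_right smult_diff_right)
    then have "L (X * R (Suc k) * f) = c * A (Suc k) + L (P (Suc k) * (X * g))
        - A (Suc k) / B k * (c * B k)"
      by (simp only: add diff smult XRP XRf)
    then show ?thesis
      using B oP'[OF below_X[OF g]] by simp
  qed
  show ?case
    using p0' A' B' oP' oR' by blast
qed

lemma A_pos: "0 < A k" and B_pos: "0 < B k"
  and P_orth: "f \<in> below k \<Longrightarrow> L (P k * f) = 0"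
  and R_orth: "f \<in> below k \<Longrightarrow> L (X * R k * f) = 0"
  using orthogonality by blast+

lemma A_0: "A 0 = 1"
  by (simp add: A_def P_0 one)

text \<open>
  Monic orthogonal polynomials have minimal norm among the monic polynomials of their degree.
\<close>

lemma A_le_moment: "A k \<le> L (X ^ (2 * k))"
proof -
  have "monic_of k (X ^ k)" for k
    by (induction k) (auto simp: monic_X, simp add: monic_of_def below_def)
  then have "L (P k * (X ^ k - P k)) = 0"
    by (intro P_orth monic_diff monic_P)
  then have "L ((P k + (X ^ k - P k))\<^sup>2) = A k + L ((X ^ k - P k)\<^sup>2)"
    unfolding square_add by (simp add: A_def)
  then show ?thesis
    using square[of "X ^ k - P k"] by (simp add: power_mult[symmetric] mult.commute)
qed

lemma X_square_nonneg: "0 \<le> L (X * p\<^sup>2)"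
  using coercive_X[of p] square[of p] eps_pos
  by (meson less_imp_le mult_nonneg_nonneg order_trans)

lemma X_square_add:
  "L (X * (p + q)\<^sup>2) = L (X * p\<^sup>2) + 2 * L (X * p * q) + L (X * q\<^sup>2)"
proof -
  have "X * (p + q)\<^sup>2 = X * p\<^sup>2 + (X * p * q + X * p * q) + X * q\<^sup>2"
    by (simp add: power2_eq_square algebra_simps)
  then show ?thesis
    by (simp only: add mult_2)
qed

lemma B_le_moment: "B k \<le> L (X ^ (2 * k + 1))"
proof -
  have "monic_of k (X ^ k)" for k
    by (induction k) (auto simp: monic_X, simp add: monic_of_def below_def)
  then have "L (X * R k * (X ^ k - R k)) = 0"
    by (intro R_orth monic_diff monic_R)
  then have "L (X * (R k + (X ^ k - R k))\<^sup>2) = B k + L (X * (X ^ k - R k)\<^sup>2)"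
    unfolding X_square_add by (simp add: B_def)
  then show ?thesis
    using X_square_nonneg[of "X ^ k - R k"] by (simp add: power_mult[symmetric] mult.commute)
qed

definition m :: "nat \<Rightarrow> real" where "m k = (poly (P k) 0)\<^sup>2 / A k"
definition l :: "nat \<Rightarrow> real" where "l k = (L (R k))\<^sup>2 / B k"

text \<open>
  The partial sum of the masses is both the value at \<open>0\<close> and the squared norm of the reproducing
  polynomial \<open>\<Sum>k<n. P k(0) / A k \<cdot> P k\<close>, to which \<open>gap\<close> applies.
\<close>

lemma sum_m_le: "(\<Sum>k<n. m k) \<le> 1 / d"
proof -
  have "\<exists>G\<in>below n. poly G 0 = (\<Sum>k<n. m k) \<and> L (G\<^sup>2) = (\<Sum>k<n. m k)"
  proof (induction n)
    case 0
    have "(0 :: real poly) \<in> below 0" by (simp add: below_def)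
    then show ?case by (intro bexI[of _ 0]) (auto simp: zero)
  next
    case (Suc n)
    then obtain G where G: "G \<in> below n" "poly G 0 = (\<Sum>k<n. m k)" "L (G\<^sup>2) = (\<Sum>k<n. m k)"
      by blast
    define c where "c = poly (P n) 0 / A n"
    have "L (G * smult c (P n)) = 0"
      using P_orth[OF G(1)] by (simp add: smult mult.commute)
    moreover have "L ((smult c (P n))\<^sup>2) = m n"
    proof -
      have "L ((smult c (P n))\<^sup>2) = c\<^sup>2 * A n"
        by (simp only: smult_power smult A_def)
      then show ?thesis
        using A_pos[of n] by (simp add: c_def m_def power2_eq_square)
    qed
    ultimately have "L ((G + smult c (P n))\<^sup>2) = (\<Sum>k<Suc n. m k)"
      unfolding square_add G by simp
    moreover have "poly (G + smult c (P n)) 0 = (\<Sum>k<Suc n. m k)"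
      by (simp add: G c_def m_def power2_eq_square)
    moreover have "G + smult c (P n) \<in> below (Suc n)"
      using G(1) monic_P[of n] below_mono[OF G(1), of "Suc n"]
      by (auto simp: monic_of_def intro!: below_add below_smult)
    ultimately show ?case by blast
  qed
  then obtain G where "poly G 0 = (\<Sum>k<n. m k)" "L (G\<^sup>2) = (\<Sum>k<n. m k)"
    by blast
  with gap[of G] have *: "d * (\<Sum>k<n. m k)\<^sup>2 \<le> (\<Sum>k<n. m k)"
    by simp
  show ?thesis
  proof (cases "(\<Sum>k<n. m k) > 0")
    case True
    with * have "d * (\<Sum>k<n. m k) \<le> 1"
      by (simp add: power2_eq_square mult.assoc[symmetric])
    then show ?thesis
      using d_pos by (simp add: field_simps)
  next
    case False
    then show ?thesis
      using d_pos by (smt (verit) divide_pos_pos)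
  qed
qed

text \<open>
  Here \<open>G = \<Sum>k<n. L (R k) / B k \<cdot> R k\<close> is the projection of \<open>1 / X\<close> onto the polynomials of
  degree less than \<open>n\<close> for the form \<open>L (X * p * q)\<close>; its squared norm is at most the value
  \<open>1 / \<epsilon>\<close> that bounds the integral of \<open>1 / X\<close>.
\<close>

lemma sum_l_le: "(\<Sum>k<n. l k) \<le> 1 / \<epsilon>"
proof -
  have "\<exists>G\<in>below n. L G = (\<Sum>k<n. l k) \<and> L (X * G\<^sup>2) = (\<Sum>k<n. l k)"
  proof (induction n)
    case 0
    have "(0 :: real poly) \<in> below 0" by (simp add: below_def)
    then show ?case by (intro bexI[of _ 0]) (auto simp: zero)
  next
    case (Suc n)
    then obtain G where G: "G \<in> below n" "L G = (\<Sum>k<n. l k)" "L (X * G\<^sup>2) = (\<Sum>k<n. l k)"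
      by blast
    define c where "c = L (R n) / B n"
    have "X * G * smult c (R n) = smult c (X * R n * G)"
      by (simp add: mult_ac)
    then have "L (X * G * smult c (R n)) = 0"
      using R_orth[OF G(1)] by (simp only: smult)
    moreover have "X * (smult c (R n))\<^sup>2 = smult (c\<^sup>2) (X * (R n)\<^sup>2)"
      by (simp add: smult_power)
    then have "L (X * (smult c (R n))\<^sup>2) = c\<^sup>2 * B n"
      by (simp only: smult B_def)
    then have "L (X * (smult c (R n))\<^sup>2) = l n"
      using B_pos[of n] by (simp add: c_def l_def power2_eq_square)
    ultimately have "L (X * (G + smult c (R n))\<^sup>2) = (\<Sum>k<Suc n. l k)"
      unfolding X_square_add G by simp
    moreover have "L (G + smult c (R n)) = (\<Sum>k<Suc n. l k)"
      by (simp add: G add smult c_def l_def power2_eq_square)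
    moreover have "G + smult c (R n) \<in> below (Suc n)"
      using G(1) monic_R[of n] below_mono[OF G(1), of "Suc n"]
      by (auto simp: monic_of_def intro!: below_add below_smult)
    ultimately show ?case by blast
  qed
  then obtain G where "L G = (\<Sum>k<n. l k)" "L (X * G\<^sup>2) = (\<Sum>k<n. l k)"
    by blast
  with cauchy_schwarz_one[of G] coercive_X[of G] eps_pos
  have *: "\<epsilon> * (\<Sum>k<n. l k)\<^sup>2 \<le> (\<Sum>k<n. l k)"
    by (metis mult_left_mono less_imp_le order_trans)
  show ?thesis
  proof (cases "(\<Sum>k<n. l k) > 0")
    case True
    with * have "\<epsilon> * (\<Sum>k<n. l k) \<le> 1"
      by (simp add: power2_eq_square mult.assoc[symmetric])
    then show ?thesis
      using eps_pos by (simp add: field_simps)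
  next
    case False
    then show ?thesis
      using eps_pos by (smt (verit) divide_pos_pos)
  qed
qed

lemma poly_P_Suc: "poly (P (Suc k)) 0 = - (B k / A k) * poly (P k) 0"
  by (simp add: P_Suc)

lemma L_R_Suc: "L (R (Suc k)) = - (A (Suc k) / B k) * L (R k)"
proof -
  have "1 \<in> below (Suc k)" by (simp add: below_def)
  from P_orth[OF this] show ?thesis
    by (simp add: R_Suc diff smult)
qed

lemma P_R_product: "\<bar>poly (P k) 0\<bar> * \<bar>L (R k)\<bar> = A k"
proof (induction k)
  case 0
  show ?case by (simp add: P_0 R_0 A_0 one)
next
  case (Suc k)
  have "\<bar>poly (P (Suc k)) 0\<bar> * \<bar>L (R (Suc k))\<bar>
      = (B k / A k) * (A (Suc k) / B k) * (\<bar>poly (P k) 0\<bar> * \<bar>L (R k)\<bar>)"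
    using A_pos[of k] B_pos[of k] A_pos[of "Suc k"]
    by (simp add: poly_P_Suc L_R_Suc abs_mult)
  with Suc show ?case
    using A_pos[of k] B_pos[of k] by simp
qed

lemma R_P_product: "\<bar>L (R k)\<bar> * \<bar>poly (P (Suc k)) 0\<bar> = B k"
proof -
  have "\<bar>L (R k)\<bar> * \<bar>poly (P (Suc k)) 0\<bar> = (B k / A k) * (\<bar>poly (P k) 0\<bar> * \<bar>L (R k)\<bar>)"
    using A_pos[of k] B_pos[of k] by (simp add: poly_P_Suc abs_mult)
  then show ?thesis
    using A_pos[of k] by (simp add: P_R_product)
qed

text \<open>
  Interlacing the two families: \<open>N n\<close> is the squared norm of the orthogonal polynomial of degree
  \<open>n\<close> of the symmetrized problem, and \<open>u n\<close> the square root of the \<open>n\<close>-th entry of the sequence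
  \<open>m 0, l 0, m 1, l 1, \<dots>\<close>.
\<close>

definition N :: "nat \<Rightarrow> real" where
  "N n = (if even n then A (n div 2) else B (n div 2))"

definition u :: "nat \<Rightarrow> real" where
  "u n = sqrt (if even n then m (n div 2) else l (n div 2))"

lemma N_pos: "0 < N n"
  by (simp add: N_def A_pos B_pos)

lemma N_le_moment: "N n \<le> L (X ^ n)"
proof (cases "even n")
  case True
  then show ?thesis using A_le_moment[of "n div 2"] by (simp add: N_def)
next
  case False
  then show ?thesis
    using B_le_moment[of "n div 2"] by (simp add: N_def odd_two_times_div_two_succ)
qed

lemma u_nonneg: "0 \<le> u n"
  using A_pos B_pos by (simp add: u_def m_def l_def less_imp_le)

text \<open>
  The product of two adjacent entries is a ratio of norms since \<open>|P k(0)| * |L (R k)|\<close> and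
  \<open>|L (R k)| * |P (Suc k)(0)|\<close> are exactly the squared norms \<open>A k\<close> and \<open>B k\<close>.
\<close>

lemma u_product: "u n * u (Suc n) = sqrt (N n / N (Suc n))"
proof (cases "even n")
  case True
  then obtain k where n: "n = 2 * k" by (elim evenE)
  have "u n * u (Suc n) = sqrt ((\<bar>poly (P k) 0\<bar> * \<bar>L (R k)\<bar>)\<^sup>2 / (A k * B k))"
    by (simp add: u_def n m_def l_def power_mult_distrib real_sqrt_mult[symmetric])
  then show ?thesis
    using A_pos[of k] unfolding P_R_product by (simp add: N_def n power2_eq_square)
next
  case False
  then obtain k where n: "n = Suc (2 * k)" by (auto elim: oddE)
  have "u n * u (Suc n) = sqrt ((\<bar>L (R k)\<bar> * \<bar>poly (P (Suc k)) 0\<bar>)\<^sup>2 / (B k * A (Suc k)))"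
    by (simp add: u_def n m_def l_def power_mult_distrib real_sqrt_mult[symmetric])
  then show ?thesis
    using B_pos[of k] unfolding R_P_product by (simp add: N_def n power2_eq_square)
qed

lemma sum_u_square_le: "(\<Sum>j<2 * n. (u j)\<^sup>2) \<le> 1 / d + 1 / \<epsilon>"
proof -
  have "(\<Sum>j<2 * n. (u j)\<^sup>2) = (\<Sum>k<n. m k) + (\<Sum>k<n. l k)"
    using A_pos B_pos by (induction n) (auto simp: u_def m_def l_def less_imp_le)
  then show ?thesis
    using sum_m_le[of n] sum_l_le[of n] by simp
qed

text \<open>
  The products \<open>u 0 * u 1 * \<dots>\<close> telescope to \<open>1 / sqrt (N n)\<close>, which dominates the terms of the
  Carleman series; Carleman's inequality and \<open>2 * u j * u (Suc j) \<le> (u j)\<^sup>2 + (u (Suc j))\<^sup>2\<close> leave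
  the sum of all masses and lengths.
\<close>

lemma carleman_sum_le:
  "(\<Sum>n<K. L (X ^ Suc n) powr (- 1 / (2 * real (Suc n)))) \<le> exp 1 * (1 / d + 1 / \<epsilon>)"
proof -
  have prod: "(\<Prod>j\<le>n. u j * u (Suc j)) = 1 / sqrt (N (Suc n))" for n
  proof (induction n)
    case 0
    show ?case by (simp add: u_product N_def A_0 real_sqrt_divide)
  next
    case (Suc n)
    then show ?case
      using N_pos[of "Suc n"] by (simp add: u_product[of "Suc n"] real_sqrt_divide)
  qed
  have "L (X ^ Suc n) powr (- 1 / (2 * real (Suc n)))
      \<le> (\<Prod>j\<le>n. u j * u (Suc j)) powr (1 / real (Suc n))" for n
  proof -
    have "L (X ^ Suc n) powr (- 1 / (2 * real (Suc n))) \<le> N (Suc n) powr (- 1 / (2 * real (Suc n)))"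
      by (intro powr_mono2' N_pos N_le_moment) simp
    also have "\<dots> = (N (Suc n) powr (- 1 / 2)) powr (1 / real (Suc n))"
      by (simp add: powr_powr)
    also have "N (Suc n) powr (- 1 / 2) = 1 / sqrt (N (Suc n))"
      using N_pos[of "Suc n"] by (simp add: powr_half_sqrt[symmetric] powr_minus_divide)
    finally show ?thesis by (simp only: prod)
  qed
  then have "(\<Sum>n<K. L (X ^ Suc n) powr (- 1 / (2 * real (Suc n))))
      \<le> (\<Sum>n<K. (\<Prod>j\<le>n. u j * u (Suc j)) powr (1 / real (Suc n)))"
    by (rule sum_mono)
  also have "\<dots> \<le> exp 1 * (\<Sum>j<K. u j * u (Suc j))"
    by (rule carleman_inequality) (simp add: u_nonneg)
  also have "(\<Sum>j<K. u j * u (Suc j)) \<le> (\<Sum>j<K. ((u j)\<^sup>2 + (u (Suc j))\<^sup>2) / 2)"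
  proof (rule sum_mono)
    fix j
    show "u j * u (Suc j) \<le> ((u j)\<^sup>2 + (u (Suc j))\<^sup>2) / 2"
      using sum_squares_bound[of "u j" "u (Suc j)"] by simp
  qed
  also have "\<dots> = ((\<Sum>j<K. (u j)\<^sup>2) + (\<Sum>j<K. (u (Suc j))\<^sup>2)) / 2"
    by (simp add: sum.distrib sum_divide_distrib[symmetric])
  also have "\<dots> \<le> (\<Sum>j<2 * Suc K. (u j)\<^sup>2)"
  proof -
    have "(\<Sum>j<K. (u j)\<^sup>2) \<le> (\<Sum>j<2 * Suc K. (u j)\<^sup>2)"
      by (rule sum_mono2) auto
    moreover have "(\<Sum>j<K. (u (Suc j))\<^sup>2) \<le> (\<Sum>j<Suc K. (u j)\<^sup>2)"
      by (simp only: sum.lessThan_Suc_shift) simp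
    moreover have "(\<Sum>j<Suc K. (u j)\<^sup>2) \<le> (\<Sum>j<2 * Suc K. (u j)\<^sup>2)"
      by (rule sum_mono2) auto
    ultimately show ?thesis by simp
  qed
  also have "\<dots> \<le> 1 / d + 1 / \<epsilon>"
    by (rule sum_u_square_le)
  finally show ?thesis by simp
qed

end

theorem carleman_imp_one_in_closure:
  assumes carleman: "(\<Sum>n. ennreal (L (X ^ Suc n) powr (- 1 / (2 * real (Suc n))))) = \<infinity>"
    and "0 < \<delta>"
  shows "\<exists>p. L ((1 - X * p)\<^sup>2) < \<delta>"
proof (rule ccontr)
  assume "\<not> ?thesis"
  then have far: "\<delta> \<le> L ((1 - X * p)\<^sup>2)" for p
    by (meson not_le)
  have gap: "\<delta> * (poly p 0)\<^sup>2 \<le> L (p\<^sup>2)" for p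
  proof -
    obtain a r where p: "p = pCons a r" by (cases p)
    show ?thesis
    proof (cases "a = 0")
      case True
      then show ?thesis using square[of p] by (simp add: p)
    next
      case False
      have "p = smult a (1 - X * smult (- inverse a) r)"
        using False by (simp add: p X_def one_pCons)
      then have "L (p\<^sup>2) = a\<^sup>2 * L ((1 - X * smult (- inverse a) r)\<^sup>2)"
        by (metis smult smult_power)
      then show ?thesis
        using mult_left_mono[OF far[of "smult (- inverse a) r"], of "a\<^sup>2"]
        by (simp add: p mult.commute)
    qed
  qed
  have "(\<Sum>n. ennreal (L (X ^ Suc n) powr (- 1 / (2 * real (Suc n)))))
      \<le> ennreal (exp 1 * (1 / \<delta> + 1 / \<epsilon>))"
    unfolding suminf_eq_SUP
  proof (rule SUP_least)
    fix K
    show "(\<Sum>n<K. ennreal (L (X ^ Suc n) powr (- 1 / (2 * real (Suc n)))))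
        \<le> ennreal (exp 1 * (1 / \<delta> + 1 / \<epsilon>))"
      using carleman_sum_le[OF \<open>0 < \<delta>\<close> gap, of K]
      by (subst sum_ennreal) (auto intro: ennreal_leI)
  qed
  then show False
    unfolding carleman by (simp add: top_unique infinity_ennreal_def)
qed

end

section \<open>Commutative abstract O*-algebras\<close>

interpretation scaleC: vector_space "scaleC :: complex \<Rightarrow> 'a \<Rightarrow> 'a::complex_star_algebra"
  by (rule vector_space_scaleC)

interpretation scale_fun: vector_space "scale_fun :: complex \<Rightarrow> ('a \<Rightarrow> complex) \<Rightarrow> 'a \<Rightarrow> complex"
  by (rule vector_space_scale_fun)

lemma star_0 [simp]: "(0 :: 'a::complex_star_algebra)\<^sup>\<star> = 0"
  using star_scaleC[of 0 "0 :: 'a"] by simp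

lemma star_1 [simp]: "(1 :: 'a::complex_star_algebra)\<^sup>\<star> = 1"
  by (metis mult.left_neutral mult.right_neutral star_mult star_star)

lemma star_minus: "(- a :: 'a::complex_star_algebra)\<^sup>\<star> = - a\<^sup>\<star>"
  by (metis add.right_inverse add_eq_0_iff star_0 star_add)

lemma star_diff: "(a - b :: 'a::complex_star_algebra)\<^sup>\<star> = a\<^sup>\<star> - b\<^sup>\<star>"
  by (metis diff_conv_add_uminus star_add star_minus)

lemma hermitian_iff: "a \<in> hermitian \<longleftrightarrow> a\<^sup>\<star> = a"
  by (simp add: hermitian_def)

locale commutative_Ostar = abstract_Ostar_algebra le \<Omega>
  for le :: "'a::complex_star_algebra \<Rightarrow> 'a \<Rightarrow> bool" and \<Omega> +
  assumes comm: "a * b = b * (a :: 'a)"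
begin

text \<open>
  The carrier is a class of possibly noncommutative algebras, so commutativity enters as an
  ordered rewrite system.
\<close>

lemma left_comm: "b * (a * c) = a * (b * (c :: 'a))"
  by (metis comm mult.assoc)

lemmas ac = mult.assoc comm left_comm

abbreviation Pos :: "'a set" where "Pos \<equiv> pos_elems le"
abbreviation Om :: "('a \<Rightarrow> complex) set" where "Om \<equiv> \<Omega> \<inter> dual_pos le"
abbreviation snorm :: "('a \<Rightarrow> complex) \<Rightarrow> 'a \<Rightarrow> real" where "snorm \<equiv> strong_seminorm"
abbreviation real_scale :: "real \<Rightarrow> 'a \<Rightarrow> 'a"  (infixr \<open>*\<^sub>r\<close> 75)
  where "r *\<^sub>r a \<equiv> complex_of_real r *\<^sub>C a"

lemma star_mult_comm: "(a * b :: 'a)\<^sup>\<star> = a\<^sup>\<star> * b\<^sup>\<star>"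
  by (simp add: star_mult comm)

lemma herm_mult: "a\<^sup>\<star> = a \<Longrightarrow> b\<^sup>\<star> = b \<Longrightarrow> (a * b :: 'a)\<^sup>\<star> = a * b"
  by (simp add: star_mult_comm)

lemma herm_power: "a\<^sup>\<star> = a \<Longrightarrow> (a ^ n :: 'a)\<^sup>\<star> = a ^ n"
  by (induction n) (simp_all add: star_mult_comm)

lemma dual_add: "\<omega> \<in> dual \<Longrightarrow> \<omega> (a + b) = \<omega> a + \<omega> (b :: 'a)"
  and dual_scale: "\<omega> \<in> dual \<Longrightarrow> \<omega> (z *\<^sub>C a) = z * \<omega> a"
  unfolding dual_def Vector_Spaces.linear_def
  by (auto dest: module_hom.add module_hom.scale)

lemma dualI:
  assumes "\<And>a b :: 'a. \<omega> (a + b) = \<omega> a + \<omega> b" "\<And>z a. \<omega> (z *\<^sub>C a) = z * \<omega> a"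
  shows "\<omega> \<in> dual"
  unfolding dual_def mem_Collect_eq using assms
  by unfold_locales (simp_all add: scaleC_add_right scaleC_add_left scaleC_scaleC scaleC_one algebra_simps)

lemma dual_diff: "\<omega> \<in> dual \<Longrightarrow> \<omega> (a - b) = \<omega> a - \<omega> (b :: 'a)"
  by (metis add_diff_cancel dual_add diff_add_cancel)

lemma dual_zero: "\<omega> \<in> dual \<Longrightarrow> \<omega> (0 :: 'a) = 0"
  by (metis dual_diff diff_self)

lemma om_dual: "\<omega> \<in> Om \<Longrightarrow> \<omega> \<in> dual"
  by (auto simp: dual_pos_def dual_hermitian_def)

lemmas om_add = dual_add[OF om_dual] and om_scale = dual_scale[OF om_dual]
  and om_diff = dual_diff[OF om_dual] and om_zero = dual_zero[OF om_dual]

lemma dual_pos_star: "\<omega> \<in> dual_pos le \<Longrightarrow> \<omega> (a\<^sup>\<star>) = cnj (\<omega> a)"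
proof -
  assume "\<omega> \<in> dual_pos le"
  then have "dual_star \<omega> = \<omega>"
    by (simp add: dual_pos_def dual_hermitian_def)
  then show ?thesis
    unfolding dual_star_def by (metis complex_cnj_cnj)
qed

lemma om_star: "\<omega> \<in> Om \<Longrightarrow> \<omega> (a\<^sup>\<star>) = cnj (\<omega> a)"
  by (simp add: dual_pos_star)

lemma om_herm_real: "\<omega> \<in> Om \<Longrightarrow> a\<^sup>\<star> = a \<Longrightarrow> Im (\<omega> a) = 0"
  by (metis om_star complex_cnj_cancel_iff complex_cnj Reals_cnj_iff complex_is_Real_iff)

lemma om_pos: "\<omega> \<in> Om \<Longrightarrow> a \<in> Pos \<Longrightarrow> 0 \<le> \<omega> a"
  by (auto simp: dual_pos_def dual_le_def)

lemma om_Re_pos: "\<omega> \<in> Om \<Longrightarrow> a \<in> Pos \<Longrightarrow> 0 \<le> Re (\<omega> a)"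
  using om_pos[of \<omega> a] by (simp add: less_eq_complex_def)

text \<open>
  Positivity in the algebra is tested on functionals, so that order relations below are obtained
  from inequalities between real numbers; reality of the values is automatic on hermitian elements.
\<close>

lemma Pos_iff: "a \<in> Pos \<longleftrightarrow> a\<^sup>\<star> = a \<and> (\<forall>\<omega>\<in>Om. 0 \<le> Re (\<omega> a))"
  using om_herm_real[of _ a]
  by (subst pos_elems_eq) (auto simp: hermitian_iff less_eq_complex_def)

lemma Pos_star: "a \<in> Pos \<Longrightarrow> a\<^sup>\<star> = a"
  by (simp add: Pos_iff)

lemma Pos_add: "a \<in> Pos \<Longrightarrow> b \<in> Pos \<Longrightarrow> a + b \<in> Pos"
  by (auto simp: Pos_iff star_add om_add)

lemma Pos_scale: "a \<in> Pos \<Longrightarrow> 0 \<le> r \<Longrightarrow> r *\<^sub>r a \<in> Pos"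
  by (auto simp: Pos_iff star_scaleC om_scale)

lemma Pos_zero: "0 \<in> Pos"
  by (auto simp: Pos_iff om_zero)

lemma le_iff: "le a b \<longleftrightarrow> a \<in> hermitian \<and> b \<in> hermitian \<and> b - a \<in> Pos"
proof
  assume "le a b"
  moreover from this have "a \<in> hermitian" "b \<in> hermitian"
    using le_hermitian by blast+
  moreover from this have "- a \<in> hermitian" by (simp add: hermitian_iff star_minus)
  ultimately show "a \<in> hermitian \<and> b \<in> hermitian \<and> b - a \<in> Pos"
    using le_add[of a b "- a"] by (simp add: pos_elems_def hermitian_iff star_diff)
next
  assume "a \<in> hermitian \<and> b \<in> hermitian \<and> b - a \<in> Pos"
  then show "le a b"
    using le_add[of 0 "b - a" a] by (simp add: pos_elems_def)
qed

lemma Pos_conj: "a \<in> Pos \<Longrightarrow> d\<^sup>\<star> * a * d \<in> Pos"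
  using le_conj[of 0 a d] le_hermitian[of 0 "d\<^sup>\<star> * a * d"]
  by (simp add: pos_elems_def)

lemma Pos_one: "1 \<in> Pos"
  using zero_le_one by (simp add: pos_elems_def hermitian_iff)

lemma Pos_star_square: "d\<^sup>\<star> * d \<in> Pos"
  using Pos_conj[OF Pos_one, of d] by simp

lemma Pos_square: "d\<^sup>\<star> = d \<Longrightarrow> d * d \<in> Pos"
  by (metis Pos_star_square)

lemma Pos_herm_conj: "d\<^sup>\<star> = d \<Longrightarrow> a \<in> Pos \<Longrightarrow> d * d * a \<in> Pos"
  using Pos_conj[of a d] by (simp add: ac)

lemma conj_act_apply: "(b \<triangleright> \<omega>) a = \<omega> (b\<^sup>\<star> * a * b)"
  by (simp add: conj_act_def biact_def)

lemma om_conj_act: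
  assumes "\<omega> \<in> Om" shows "b \<triangleright> \<omega> \<in> Om"
proof -
  have "b \<triangleright> \<omega> \<in> \<Omega>"
    unfolding conj_act_def using assms Omega_biact by blast
  moreover from this have "b \<triangleright> \<omega> \<in> dual"
    using Omega_dual by blast
  moreover have "dual_star (b \<triangleright> \<omega>) = b \<triangleright> \<omega>"
    using om_star[OF assms, symmetric]
    by (simp add: dual_star_def conj_act_apply fun_eq_iff star_mult star_star mult.assoc)
  ultimately show ?thesis
    using om_pos[OF assms Pos_conj]
    by (auto simp: dual_pos_def dual_hermitian_def dual_le_def conj_act_apply)
qed

lemma om_sum:
  assumes "\<omega> \<in> Om" "\<rho> \<in> Om" shows "\<omega> + \<rho> \<in> Om"
proof -
  have "\<omega> + \<rho> \<in> \<Omega>"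
    using assms scale_fun.subspace_add[OF Omega_subspace] by blast
  then show ?thesis
    using assms Omega_dual om_star[OF assms(1), symmetric] om_star[OF assms(2), symmetric]
      om_pos[OF assms(1)] om_pos[OF assms(2)]
    by (auto simp: dual_pos_def dual_hermitian_def dual_le_def dual_star_def fun_eq_iff star_star)
qed

lemma om_scale_fun:
  assumes "\<omega> \<in> Om" "0 \<le> K" shows "scale_fun (complex_of_real K) \<omega> \<in> Om"
proof -
  have "scale_fun K \<omega> \<in> \<Omega>"
    using assms scale_fun.subspace_scale[OF Omega_subspace] by blast
  then show ?thesis
    using assms Omega_dual om_star[OF assms(1), symmetric] om_pos[OF assms(1)]
    by (auto simp: dual_pos_def dual_hermitian_def dual_le_def dual_star_def fun_eq_iff
        star_star scale_fun_def less_eq_complex_def)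
qed

end

section \<open>The GNS seminorms\<close>

context commutative_Ostar
begin

lemma snorm_square: "\<omega> \<in> Om \<Longrightarrow> (snorm \<omega> a)\<^sup>2 = Re (\<omega> (a\<^sup>\<star> * a))"
  by (simp add: strong_seminorm_def om_Re_pos Pos_star_square)

lemma snorm_nonneg: "\<omega> \<in> Om \<Longrightarrow> 0 \<le> snorm \<omega> a"
  by (simp add: strong_seminorm_def om_Re_pos Pos_star_square)

text \<open>
  In the commutative case, multiplication by \<open>b\<close> is absorbed into the functional. Hence an
  approximation that is possible for every functional can be made in finitely many seminorms
  \<open>a \<mapsto> snorm \<omega> (b * a)\<close> at once: pass to a sum of functionals \<open>b \<triangleright> \<omega>\<close>.
\<close>

lemma snorm_mult: "snorm \<omega> (b * a) = snorm (b \<triangleright> \<omega>) a"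
  by (simp add: strong_seminorm_def conj_act_apply star_mult_comm ac)

lemma snorm_sum:
  assumes "\<omega> \<in> Om" "\<rho> \<in> Om"
  shows "snorm \<omega> a \<le> snorm (\<omega> + \<rho>) a" "snorm \<rho> a \<le> snorm (\<omega> + \<rho>) a"
  using assms by (auto simp: strong_seminorm_def om_Re_pos Pos_star_square)

lemma snorm_scale_fun: "0 \<le> K \<Longrightarrow> snorm (scale_fun (complex_of_real K) \<omega>) a = sqrt K * snorm \<omega> a"
  by (simp add: strong_seminorm_def scale_fun_def real_sqrt_mult)

lemma snorm_minus: "snorm \<omega> (a - b) = snorm \<omega> (b - a)"
proof -
  have "(a - b)\<^sup>\<star> * (a - b) = (b - a)\<^sup>\<star> * (b - a)"
    by (simp add: star_diff algebra_simps)
  then show ?thesis by (simp add: strong_seminorm_def)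
qed

lemma cauchy_schwarz:
  assumes \<omega>: "\<omega> \<in> Om"
  shows "cmod (\<omega> (a\<^sup>\<star> * b)) \<le> snorm \<omega> a * snorm \<omega> b"
proof -
  define w where "w = \<omega> (a\<^sup>\<star> * b)"
  have w': "\<omega> (b\<^sup>\<star> * a) = cnj w"
    using om_star[OF \<omega>, of "a\<^sup>\<star> * b"] by (simp add: w_def star_mult star_star)
  \<comment> \<open>Positivity on \<open>a + z b\<close> for \<open>z\<close> on the real line through \<open>cnj w\<close>.\<close>
  have quad: "0 \<le> (snorm \<omega> a)\<^sup>2 + 2 * t * (cmod w)\<^sup>2 + t\<^sup>2 * (cmod w)\<^sup>2 * (snorm \<omega> b)\<^sup>2" for t :: real
  proof -
    define z where "z = complex_of_real t * cnj w"
    have "(a + z *\<^sub>C b)\<^sup>\<star> * (a + z *\<^sub>C b)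
        = a\<^sup>\<star> * a + z *\<^sub>C (a\<^sup>\<star> * b) + cnj z *\<^sub>C (b\<^sup>\<star> * a) + (cnj z * z) *\<^sub>C (b\<^sup>\<star> * b)"
      by (simp add: star_add star_scaleC distrib_left distrib_right mult_scaleC_left mult_scaleC_right
          scaleC_add_right scaleC_scaleC mult.commute)
    then have "\<omega> ((a + z *\<^sub>C b)\<^sup>\<star> * (a + z *\<^sub>C b))
        = \<omega> (a\<^sup>\<star> * a) + z * w + cnj z * cnj w + (cnj z * z) * \<omega> (b\<^sup>\<star> * b)"
      by (simp only: om_add[OF \<omega>] om_scale[OF \<omega>] w_def[symmetric] w')
    moreover have "z * w = of_real (t * (cmod w)\<^sup>2)" "cnj z * cnj w = of_real (t * (cmod w)\<^sup>2)"
      "cnj z * z = of_real (t\<^sup>2 * (cmod w)\<^sup>2)"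
      using complex_norm_square[of w] by (simp_all add: z_def power2_eq_square mult_ac)
    moreover have "0 \<le> Re (\<omega> ((a + z *\<^sub>C b)\<^sup>\<star> * (a + z *\<^sub>C b)))"
      by (intro om_Re_pos \<omega> Pos_star_square)
    ultimately show ?thesis
      by (simp add: snorm_square[OF \<omega>] del: of_real_mult of_real_power)
  qed
  have "(cmod w)\<^sup>2 \<le> (snorm \<omega> a)\<^sup>2 * (snorm \<omega> b)\<^sup>2"
  proof (cases "snorm \<omega> b = 0")
    case True
    have "cmod w = 0"
    proof (rule ccontr)
      assume nz: "cmod w \<noteq> 0"
      from quad[of "- ((snorm \<omega> a)\<^sup>2 + 1) / (2 * (cmod w)\<^sup>2)"] True nz show False
        by (simp add: field_simps)
    qed
    then show ?thesis by simp
  next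
    case False
    then have b: "0 < (snorm \<omega> b)\<^sup>2" by simp
    have "(- 1 / y)\<^sup>2 * x * y = x / y" if "0 < y" for x y :: real
      using that by (simp add: power2_eq_square)
    note this[OF b, of "(cmod w)\<^sup>2"]
    with quad[of "- 1 / (snorm \<omega> b)\<^sup>2"]
    have "(cmod w)\<^sup>2 / (snorm \<omega> b)\<^sup>2 \<le> (snorm \<omega> a)\<^sup>2"
      by simp
    then show ?thesis
      using b by (simp add: pos_divide_le_eq)
  qed
  then show ?thesis
    unfolding w_def[symmetric] using snorm_nonneg[OF \<omega>]
    by (metis mult_nonneg_nonneg power2_le_imp_le power_mult_distrib)
qed

lemma snorm_star: "snorm \<omega> (a\<^sup>\<star>) = snorm \<omega> a"
  by (simp add: strong_seminorm_def star_star comm)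

lemma cauchy_schwarz_mult:
  assumes "\<omega> \<in> Om" shows "cmod (\<omega> (a * b)) \<le> snorm \<omega> a * snorm \<omega> b"
  using cauchy_schwarz[OF assms, of "a\<^sup>\<star>" b] by (simp add: star_star snorm_star)

lemma snorm_triangle:
  assumes \<omega>: "\<omega> \<in> Om"
  shows "snorm \<omega> (a + b) \<le> snorm \<omega> a + snorm \<omega> b"
proof -
  have "(snorm \<omega> (a + b))\<^sup>2 = (snorm \<omega> a)\<^sup>2 + Re (\<omega> (a\<^sup>\<star> * b)) + Re (\<omega> (b\<^sup>\<star> * a)) + (snorm \<omega> b)\<^sup>2"
    by (simp add: snorm_square[OF \<omega>] star_add distrib_left distrib_right om_add[OF \<omega>])
  also have "\<dots> \<le> (snorm \<omega> a + snorm \<omega> b)\<^sup>2"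
    using complex_Re_le_cmod[of "\<omega> (a\<^sup>\<star> * b)"] complex_Re_le_cmod[of "\<omega> (b\<^sup>\<star> * a)"]
      cauchy_schwarz[OF \<omega>, of a b] cauchy_schwarz[OF \<omega>, of b a]
      mult.commute[of "snorm \<omega> b" "snorm \<omega> a"]
    unfolding power2_sum by linarith
  finally show ?thesis
    using snorm_nonneg[OF \<omega>] by (metis add_nonneg_nonneg power2_le_imp_le)
qed


end

section \<open>Stieltjes states and multiples of coercive elements\<close>

definition peval :: "'a::complex_star_algebra \<Rightarrow> real poly \<Rightarrow> 'a" where
  "peval q p = fold_coeffs (\<lambda>a b. complex_of_real a *\<^sub>C 1 + q * b) p 0"

lemma peval_0 [simp]: "peval q 0 = 0"
  by (simp add: peval_def)

lemma peval_pCons: "peval q (pCons a p) = complex_of_real a *\<^sub>C 1 + q * peval q p"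
  by (cases "p = 0 \<and> a = 0") (auto simp: peval_def)

lemma peval_add: "peval q (p + p') = peval q p + peval q p'"
  by (induction p p' rule: poly_induct2)
    (simp_all add: peval_pCons scaleC_add_left distrib_left)

lemma peval_smult: "peval q (smult c p) = complex_of_real c *\<^sub>C peval q p"
  by (induction p)
    (simp_all add: peval_pCons scaleC_add_right scaleC_scaleC mult_scaleC_right)

lemma peval_mult: "peval q (p * p') = peval q p * peval q p'"
  by (induction p)
    (simp_all add: peval_pCons peval_add peval_smult distrib_right mult_scaleC_left mult.assoc)

lemma peval_1: "peval q 1 = 1"
  by (simp add: one_pCons peval_pCons scaleC_one)

lemma peval_X: "peval q [:0, 1:] = q"
  by (simp add: peval_pCons scaleC_one)

lemma peval_power: "peval q (p ^ n) = peval q p ^ n"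
  by (induction n) (simp_all add: peval_1 peval_mult)

context commutative_Ostar
begin

lemma peval_herm: "(q :: 'a)\<^sup>\<star> = q \<Longrightarrow> (peval q p)\<^sup>\<star> = peval q p"
  by (induction p) (simp_all add: peval_pCons star_add star_scaleC star_mult_comm)

text \<open>
  In every GNS representation, the range of multiplication by the hermitian element \<open>q\<close> comes
  arbitrarily close to the cyclic vector. Since the functional may be replaced by \<open>b \<triangleright> \<tau>\<close>, the
  range is then dense.
\<close>

definition dense_range :: "'a \<Rightarrow> bool" where
  "dense_range q \<longleftrightarrow> q\<^sup>\<star> = q \<and>
     (\<forall>\<tau>\<in>Om. \<forall>\<delta>>0. \<exists>c. c\<^sup>\<star> = c \<and> snorm \<tau> (1 - q * c) < \<delta>)"

lemma coerciveE:
  assumes "coercive le q"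
  obtains \<epsilon> where "0 < \<epsilon>" "q \<in> Pos" "q - \<epsilon> *\<^sub>r 1 \<in> Pos"
proof -
  from assms obtain \<epsilon> where "0 < \<epsilon>" "q \<in> Pos" "le (\<epsilon> *\<^sub>r 1) q"
    unfolding coercive_def by blast
  moreover from this have "q - \<epsilon> *\<^sub>r 1 \<in> Pos"
    by (simp add: le_iff)
  ultimately show ?thesis by (intro that)
qed

text \<open>
  Evaluating real polynomials at \<open>q\<close> pulls \<open>\<omega>\<close> back to a coercive moment functional, so the element
  \<open>c\<close> can be chosen as a polynomial in \<open>q\<close>. The Stieltjes condition is applied to \<open>\<omega>\<close>
  itself, whose first moment is nonzero because \<open>q\<close> is coercive.
\<close>

lemma stieltjes_state_approx:
  assumes q: "coercive le q" and st: "stieltjes_state le \<Omega> q \<omega>" and "0 < \<delta>"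
  shows "\<exists>c. c\<^sup>\<star> = c \<and> snorm \<omega> (1 - q * c) < \<delta>"
proof -
  obtain \<epsilon> where \<epsilon>: "0 < \<epsilon>" and qP: "q \<in> Pos" and q\<epsilon>: "q - \<epsilon> *\<^sub>r 1 \<in> Pos"
    using coerciveE[OF q] .
  have \<omega>: "\<omega> \<in> Om" and \<omega>1: "\<omega> 1 = 1"
    using st by (auto simp: stieltjes_state_def states_def)
  have qh: "q\<^sup>\<star> = q" using qP by (rule Pos_star)
  define L where "L p = Re (\<omega> (peval q p))" for p
  interpret coercive_moment_functional L \<epsilon>
  proof
    fix p p' :: "real poly" and c :: real
    show "L (p + p') = L p + L p'"
      by (simp add: L_def peval_add om_add[OF \<omega>])
    show "L (smult c p) = c * L p"
      by (simp add: L_def peval_smult om_scale[OF \<omega>])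
    show "L 1 = 1"
      by (simp add: L_def peval_1 \<omega>1)
    show "0 \<le> L (p ^ 2)"
      unfolding L_def power2_eq_square peval_mult
      by (intro om_Re_pos \<omega> Pos_square peval_herm qh)
    have "peval q p * peval q p * (q - \<epsilon> *\<^sub>r 1) \<in> Pos"
      by (intro Pos_herm_conj q\<epsilon> peval_herm qh)
    moreover have "peval q p * peval q p * (q - \<epsilon> *\<^sub>r 1)
        = q * (peval q p * peval q p) - \<epsilon> *\<^sub>r (peval q p * peval q p)"
      by (simp add: comm[of _ "q - \<epsilon> *\<^sub>r 1"] left_diff_distrib mult_scaleC_left)
    ultimately have "0 \<le> Re (\<omega> (q * (peval q p * peval q p) - \<epsilon> *\<^sub>r (peval q p * peval q p)))"
      using om_Re_pos[OF \<omega>] by metis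
    then show "\<epsilon> * L (p ^ 2) \<le> L ([:0, 1:] * p ^ 2)"
      by (simp add: L_def power2_eq_square peval_mult peval_X om_diff[OF \<omega>]
          om_scale[OF \<omega>] del: mult_pCons_left)
    show "0 < \<epsilon>" by (rule \<epsilon>)
  qed
  have "0 \<le> Re (\<omega> (q - \<epsilon> *\<^sub>r 1))"
    by (intro om_Re_pos \<omega> q\<epsilon>)
  then have "Re (\<omega> q) \<noteq> 0"
    using \<epsilon> by (simp add: om_diff[OF \<omega>] om_scale[OF \<omega>] \<omega>1)
  then have "\<omega> q \<noteq> 0"
    by auto
  moreover have "Re (\<omega> (q ^ n)) = L (X ^ n)" for n
    by (simp add: L_def peval_power X_def peval_X del: mult_pCons_left)
  moreover have "\<omega> (1\<^sup>\<star> * 1) = 1"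
    by (simp add: \<omega>1)
  then have "(1 \<triangleright> \<omega>) q = 0 \<or>
        (\<Sum>n. ennreal (Re ((1 \<triangleright> \<omega>) (q ^ Suc n)) powr (- 1 / (2 * real (Suc n))))) = \<infinity>"
    using st unfolding stieltjes_state_def by blast
  ultimately have "(\<Sum>n. ennreal (L (X ^ Suc n) powr (- 1 / (2 * real (Suc n))))) = \<infinity>"
    by (simp add: conj_act_apply del: power_Suc)
  then obtain p where p: "L ((1 - X * p)\<^sup>2) < \<delta>\<^sup>2"
    using carleman_imp_one_in_closure[of "\<delta>\<^sup>2"] \<open>0 < \<delta>\<close> by auto
  have ph: "(peval q p)\<^sup>\<star> = peval q p"
    by (rule peval_herm[OF qh])
  have ev: "peval q (1 - X * p) = 1 - q * peval q p"
    using peval_add[of q "1 - X * p" "X * p"]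
    by (simp only: diff_add_cancel) (simp add: peval_1 peval_mult X_def peval_X eq_diff_eq del: mult_pCons_left)
  have "(snorm \<omega> (1 - q * peval q p))\<^sup>2 < \<delta>\<^sup>2"
    using p by (simp add: snorm_square[OF \<omega>] L_def power2_eq_square[of "1 - X * p"] peval_mult ev
        star_diff star_mult_comm qh ph)
  then have "snorm \<omega> (1 - q * peval q p) < \<delta>"
    using \<open>0 < \<delta>\<close> by (simp add: power2_less_imp_less)
  with ph show ?thesis by blast
qed

lemma stieltjes_dense_range:
  assumes q: "coercive le q" and st: "\<And>\<omega>. \<omega> \<in> states le \<Omega> \<Longrightarrow> stieltjes_state le \<Omega> q \<omega>"
  shows "dense_range q"
  unfolding dense_range_def
proof (intro conjI ballI allI impI)
  show "q\<^sup>\<star> = q"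
    using q by (auto simp: coercive_def Pos_star)
  fix \<tau> and \<delta> :: real
  assume \<tau>: "\<tau> \<in> Om" and \<delta>: "0 < \<delta>"
  show "\<exists>c. c\<^sup>\<star> = c \<and> snorm \<tau> (1 - q * c) < \<delta>"
  proof (cases "Re (\<tau> 1) = 0")
    case True
    then have "snorm \<tau> (1 - q * 0) = 0"
      by (simp add: strong_seminorm_def)
    with \<delta> show ?thesis
      by (metis star_0)
  next
    case False
    define t where "t = Re (\<tau> 1)"
    have t: "0 < t"
      using False om_Re_pos[OF \<tau> Pos_one] by (simp add: t_def)
    have "\<tau> 1 = of_real t"
      using om_herm_real[OF \<tau>, of 1] by (simp add: t_def complex_eq_iff)
    define \<omega> where "\<omega> = scale_fun (of_real (1 / t)) \<tau>"
    have "\<omega> \<in> states le \<Omega>"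
      using om_scale_fun[OF \<tau>, of "1 / t"] t \<open>\<tau> 1 = of_real t\<close>
      by (simp add: states_def \<omega>_def scale_fun_def)
    then obtain c where "c\<^sup>\<star> = c" "snorm \<omega> (1 - q * c) < \<delta> / sqrt t"
      using stieltjes_state_approx[OF q st, of \<omega> "\<delta> / sqrt t"] \<delta> t by auto
    moreover from this have "snorm \<tau> (1 - q * c) < \<delta>"
      using t by (simp add: \<omega>_def snorm_scale_fun real_sqrt_divide field_simps del: of_real_divide)
    ultimately show ?thesis by blast
  qed
qed

text \<open>
  Once \<open>1\<close> is approximated by \<open>q * c\<close>, it is approximated by \<open>q * c * (r * e)\<close> if \<open>r * e\<close> is close
  to \<open>1\<close> with respect to the translated functional \<open>(q * c) \<triangleright> \<tau>\<close>.
\<close>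

lemma dense_range_mult:
  assumes q: "dense_range q" and r: "dense_range r"
  shows "dense_range (q * r)"
  unfolding dense_range_def
proof (intro conjI ballI allI impI)
  show "(q * r)\<^sup>\<star> = q * r"
    using q r by (simp add: dense_range_def herm_mult)
  fix \<tau> and \<delta> :: real
  assume \<tau>: "\<tau> \<in> Om" and \<delta>: "0 < \<delta>"
  obtain c where c: "c\<^sup>\<star> = c" "snorm \<tau> (1 - q * c) < \<delta> / 2"
    using q \<tau> \<delta> unfolding dense_range_def by (meson half_gt_zero)
  obtain e where e: "e\<^sup>\<star> = e" "snorm ((q * c) \<triangleright> \<tau>) (1 - r * e) < \<delta> / 2"
    using r om_conj_act[OF \<tau>] \<delta> unfolding dense_range_def by (meson half_gt_zero)
  have "1 - q * r * (c * e) = (1 - q * c) + q * c * (1 - r * e)"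
    by (simp add: algebra_simps left_comm)
  then have "snorm \<tau> (1 - q * r * (c * e)) \<le> snorm \<tau> (1 - q * c) + snorm \<tau> (q * c * (1 - r * e))"
    using snorm_triangle[OF \<tau>] by metis
  also have "\<dots> < \<delta>"
    using c e by (simp add: snorm_mult[of \<tau> "q * c"])
  finally show "\<exists>c. c\<^sup>\<star> = c \<and> snorm \<tau> (1 - q * r * c) < \<delta>"
    using c(1) e(1) by (metis herm_mult)
qed

lemma dense_range_scale:
  assumes q: "dense_range q" and r: "r \<noteq> 0"
  shows "dense_range (r *\<^sub>r q)"
  unfolding dense_range_def
proof (intro conjI ballI allI impI)
  show "(r *\<^sub>r q)\<^sup>\<star> = r *\<^sub>r q"
    using q by (simp add: dense_range_def star_scaleC)
  fix \<tau> and \<delta> :: real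
  assume \<tau>: "\<tau> \<in> Om" and \<delta>: "0 < \<delta>"
  obtain c where c: "c\<^sup>\<star> = c" "snorm \<tau> (1 - q * c) < \<delta>"
    using q \<tau> \<delta> unfolding dense_range_def by blast
  have "(r *\<^sub>r q) * ((1 / r) *\<^sub>r c) = q * c"
    using r by (simp add: mult_scaleC_left mult_scaleC_right scaleC_scaleC scaleC_one)
  moreover have "((1 / r) *\<^sub>r c)\<^sup>\<star> = (1 / r) *\<^sub>r c"
    using c by (simp add: star_scaleC)
  ultimately show "\<exists>c. c\<^sup>\<star> = c \<and> snorm \<tau> (1 - (r *\<^sub>r q) * c) < \<delta>"
    using c by metis
qed

lemma dense_range_one: "dense_range 1"
  unfolding dense_range_def
proof (intro conjI ballI allI impI exI)
  fix \<tau> and \<delta> :: real assume "\<tau> \<in> Om" "0 < \<delta>"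
  show "snorm \<tau> (1 - 1 * 1) < \<delta>"
    using \<open>\<tau> \<in> Om\<close> \<open>0 < \<delta>\<close> by (simp add: strong_seminorm_def om_zero)
qed simp_all

lemma dense_range_power: "dense_range q \<Longrightarrow> dense_range (q ^ n)"
  by (induction n) (simp_all add: dense_range_one dense_range_mult)

end

section \<open>Products of positive elements\<close>

context commutative_Ostar
begin

text \<open>
  F. Riesz' proof that a product of commuting positive operators is positive writes an operator
  \<open>0 \<le> t \<le> 1\<close> as \<open>t = t\<^sub>0\<^sup>2 + \<dots> + t\<^sub>n\<^sub>-\<^sub>1\<^sup>2 + t\<^sub>n\<close> with \<open>t\<^sub>0 = t\<close> and \<open>t\<^sub>i\<^sub>+\<^sub>1 = t\<^sub>i - t\<^sub>i\<^sup>2\<close>. Here it is used for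
  \<open>t = a / r\<^sup>2\<close>, which is not available in the algebra; the lemma is the version with the
  denominators cleared by the power \<open>S = r ^ (2 * k + 2)\<close>, so that \<open>E i\<close> stands for \<open>S * t\<^sub>i\<close>. The
  exponent depends on the number of steps, because each step introduces new denominators.
\<close>

lemma riesz_iteration:
  assumes r: "r\<^sup>\<star> = r" and a: "a \<in> Pos" and ra: "r * r - a \<in> Pos"
  obtains k E where "E 0 = r ^ k * r ^ k * a"
    "\<And>i. i < n \<Longrightarrow> r ^ (k + 1) * r ^ (k + 1) * E (Suc i) = r ^ (k + 1) * r ^ (k + 1) * E i - E i * E i"
    "\<And>i. i \<le> n \<Longrightarrow> E i \<in> Pos"
    "\<And>i. i \<le> n \<Longrightarrow> r ^ (k + 1) * r ^ (k + 1) - E i \<in> Pos"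
proof -
  have "\<exists>k E. E 0 = r ^ k * r ^ k * a \<and>
     (\<forall>i<n. r ^ (k + 1) * r ^ (k + 1) * E (Suc i) = r ^ (k + 1) * r ^ (k + 1) * E i - E i * E i) \<and>
     (\<forall>i\<le>n. E i \<in> Pos \<and> r ^ (k + 1) * r ^ (k + 1) - E i \<in> Pos)"
  proof (induction n)
    case 0
    show ?case
      using a ra by (intro exI[of _ 0] exI[of _ "\<lambda>_. a"]) simp
  next
    case (Suc n)
    then obtain k E where E0: "E 0 = r ^ k * r ^ k * a"
      and rec: "\<And>i. i < n \<Longrightarrow> r ^ (k + 1) * r ^ (k + 1) * E (Suc i) = r ^ (k + 1) * r ^ (k + 1) * E i - E i * E i"
      and pos: "\<And>i. i \<le> n \<Longrightarrow> E i \<in> Pos"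
      and pos': "\<And>i. i \<le> n \<Longrightarrow> r ^ (k + 1) * r ^ (k + 1) - E i \<in> Pos"
      by blast
    define s where "s = r ^ (k + 1)"
    define S where "S = s * s"
    have s: "s\<^sup>\<star> = s" unfolding s_def by (rule herm_power[OF r])
    have S: "S\<^sup>\<star> = S" unfolding S_def by (rule herm_mult[OF s s])
    note rec = rec[folded s_def, folded S_def] and pos' = pos'[folded s_def, folded S_def]
    \<comment> \<open>The next denominator is \<open>S ^ 3\<close>, that is \<open>r ^ (2 * k' + 2)\<close>.\<close>
    define k' where "k' = 3 * k + 2"
    have rk': "r ^ k' = s * s * r ^ k"
      unfolding k'_def s_def power_add[symmetric] by (rule arg_cong[where f = "power r"]) simp
    have S': "r ^ (k' + 1) * r ^ (k' + 1) = S * S * S"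
    proof -
      have "r ^ (k' + 1) = s * s * s"
        unfolding k'_def s_def power_add[symmetric] by (rule arg_cong[where f = "power r"]) simp
      then show ?thesis by (simp only: S_def ac)
    qed
    define E' where "E' i = (if i \<le> n then S * S * E i else S * E n * (S - E n))" for i
    have "E' 0 = r ^ k' * r ^ k' * a"
      by (simp add: E'_def E0 rk' S_def ac)
    moreover have "S * S * S * E' (Suc i) = S * S * S * E' i - E' i * E' i" if "i < Suc n" for i
    proof (cases "i < n")
      case True
      then have "S * S * S * E' (Suc i) = S * S * S * S * (S * E (Suc i))"
        by (simp add: E'_def ac)
      also have "\<dots> = S * S * S * E' i - E' i * E' i"
        using True by (simp add: rec E'_def right_diff_distrib ac)
      finally show ?thesis .
    next
      case False
      with that have "i = n" by simp
      then show ?thesis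
        by (simp add: E'_def right_diff_distrib ac)
    qed
    moreover have "E' i \<in> Pos \<and> S * S * S - E' i \<in> Pos" if "i \<le> Suc n" for i
    proof (cases "i \<le> n")
      case True
      have "S * S * (S - E i) \<in> Pos" "S * S * E i \<in> Pos"
        using True by (intro Pos_herm_conj S pos pos'; simp)+
      with True show ?thesis
        by (simp add: E'_def right_diff_distrib)
    next
      case False
      with that have i: "i = Suc n" by simp
      have e: "(E n)\<^sup>\<star> = E n" and Se: "(S - E n)\<^sup>\<star> = S - E n"
        using pos[of n] pos'[of n] by (auto intro: Pos_star)
      have "E n * E n * (S - E n) + (S - E n) * (S - E n) * E n \<in> Pos"
        by (intro Pos_add Pos_herm_conj e Se pos pos') simp_all
      moreover have "E n * E n * (S - E n) + (S - E n) * (S - E n) * E n = E' i"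
        by (simp add: i E'_def right_diff_distrib left_diff_distrib ac)
      moreover have "S * S * (S - E n) + (s * E n) * (s * E n) \<in> Pos"
        by (intro Pos_add Pos_herm_conj Pos_square herm_mult s S e pos') simp_all
      moreover have "S * S * (S - E n) + (s * E n) * (s * E n) = S * S * S - E' i"
        by (simp add: i E'_def right_diff_distrib left_diff_distrib S_def ac)
      ultimately show ?thesis by metis
    qed
    ultimately show ?case
      unfolding S'[symmetric] by blast
  qed
  then show ?thesis
    using that by blast
qed

lemma snorm_diff_le: "\<omega> \<in> Om \<Longrightarrow> snorm \<omega> a \<le> snorm \<omega> b + snorm \<omega> (b - a)"
  using snorm_triangle[of \<omega> b "a - b"] by (simp add: snorm_minus[of \<omega> a b])

text \<open>
  The functional \<open>\<omega>\<close> is replaced by its translate by \<open>v = S * c\<close>, an approximation of \<open>1\<close>, where \<open>S\<close>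
  is the common denominator of the Riesz iteration. Under the translated functional the elements
  \<open>t\<^sub>i = E i / S\<close> may be treated as if they existed. The squares in the decomposition of \<open>t = a / r\<^sup>2\<close>
  contribute nonnegative terms to the value at \<open>a * x\<close>, so that only the remainder \<open>t\<^sub>i\<close> matters.
  Its size at the vector in question can be made small: the squares of these sizes have a bounded
  sum over \<open>i < n\<close>, so one of them is at most \<open>1 / n\<close> times the bound, and the decomposition is
  stopped there. All estimates are uniform in \<open>n\<close>, although \<open>S\<close> and \<open>c\<close> depend on it.
\<close>

lemma mult_nonneg_of_square_bound:
  assumes r: "dense_range r" and a: "a \<in> Pos" and ra: "r * r - a \<in> Pos"
    and x: "x \<in> Pos" and \<omega>: "\<omega> \<in> Om"
  shows "0 \<le> Re (\<omega> (a * x))"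
proof -
  have rh: "r\<^sup>\<star> = r" using r by (simp add: dense_range_def)
  have ah: "a\<^sup>\<star> = a" and xh: "x\<^sup>\<star> = x" using a x by (auto intro: Pos_star)
  define C where "C = (snorm \<omega> x + 1) * (snorm \<omega> (r * r) + 1) + 2 * snorm \<omega> (a * x) + 1"
  have bound: "- C * (1 / real (Suc N)) \<le> Re (\<omega> (a * x))" for N
  proof -
    define \<delta> where "\<delta> = 1 / real (Suc N)"
    have \<delta>: "0 < \<delta>" "\<delta> \<le> 1" by (simp_all add: \<delta>_def)
    \<comment> \<open>The square of \<open>Suc N\<close> makes \<open>1 / sqrt n\<close>, the relative size of the remainder, equal to \<open>\<delta>\<close>.\<close>
    define n where "n = (Suc N)\<^sup>2"
    have n: "0 < n" "sqrt (real n) = real (Suc N)" by (simp_all add: n_def del: of_nat_Suc)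
    obtain k E where E0: "E 0 = r ^ k * r ^ k * a"
      and rec: "\<And>i. i < n \<Longrightarrow> r ^ (k + 1) * r ^ (k + 1) * E (Suc i) = r ^ (k + 1) * r ^ (k + 1) * E i - E i * E i"
      and pos: "\<And>i. i \<le> n \<Longrightarrow> E i \<in> Pos"
      and pos': "\<And>i. i \<le> n \<Longrightarrow> r ^ (k + 1) * r ^ (k + 1) - E i \<in> Pos"
      by (rule riesz_iteration[OF rh a ra, where n = n], rule that)
    define s where "s = r ^ (k + 1)"
    define S where "S = s * s"
    note rec = rec[folded s_def, folded S_def] and pos' = pos'[folded s_def, folded S_def]
    have s: "s\<^sup>\<star> = s" unfolding s_def by (rule herm_power[OF rh])
    have S: "S\<^sup>\<star> = S" unfolding S_def by (rule herm_mult[OF s s])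
    have Sd: "dense_range S"
      unfolding S_def s_def by (intro dense_range_mult dense_range_power r)
    have Sa: "S * a = r * r * E 0"
      by (simp add: S_def s_def E0 ac)
    have Eh: "(E i)\<^sup>\<star> = E i" if "i \<le> n" for i
      using pos[OF that] by (rule Pos_star)
    \<comment> \<open>One functional controls all the seminorms in which \<open>v\<close> has to be close to \<open>1\<close>.\<close>
    define \<tau> where "\<tau> = \<omega> + (x \<triangleright> \<omega> + ((r * r) \<triangleright> \<omega> + a \<triangleright> \<omega>))"
    note om = \<omega> om_conj_act[OF \<omega>] om_sum
    have \<tau>: "\<tau> \<in> Om" unfolding \<tau>_def by (intro om)
    obtain c where c: "c\<^sup>\<star> = c" and c\<delta>: "snorm \<tau> (1 - S * c) < \<delta>"
      using Sd \<tau> \<delta> unfolding dense_range_def by blast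
    define v where "v = S * c"
    define h where "h = 1 - v"
    have v: "v\<^sup>\<star> = v" unfolding v_def by (rule herm_mult[OF S c])
    have h: "h\<^sup>\<star> = h" unfolding h_def by (simp add: star_diff v)
    have small: "snorm \<omega> h \<le> \<delta>" "snorm \<omega> (x * h) \<le> \<delta>" "snorm \<omega> (r * r * h) \<le> \<delta>" "snorm \<omega> (a * h) \<le> \<delta>"
    proof -
      have *: "snorm \<tau> h < \<delta>" using c\<delta> by (simp add: h_def v_def)
      have "snorm \<omega> h \<le> snorm \<tau> h" "snorm (x \<triangleright> \<omega>) h \<le> snorm \<tau> h"
        "snorm ((r * r) \<triangleright> \<omega>) h \<le> snorm \<tau> h" "snorm (a \<triangleright> \<omega>) h \<le> snorm \<tau> h"
        unfolding \<tau>_def by (meson om snorm_sum order_trans)+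
      with * show "snorm \<omega> h \<le> \<delta>" "snorm \<omega> (x * h) \<le> \<delta>" "snorm \<omega> (r * r * h) \<le> \<delta>" "snorm \<omega> (a * h) \<le> \<delta>"
        by (simp_all add: snorm_mult[of \<omega> x] snorm_mult[of \<omega> "r * r"] snorm_mult[of \<omega> a])
    qed
    define w where "w = r * r * c"
    have w: "w\<^sup>\<star> = w" unfolding w_def by (intro herm_mult rh c)
    have sum_eq: "(\<Sum>i<j. (snorm \<omega> (w * E i))\<^sup>2) = Re (\<omega> (w * w * (S * E 0 - S * E j)))" if "j \<le> n" for j
      using that
    proof (induction j)
      case 0
      show ?case by (simp add: om_zero[OF \<omega>])
    next
      case (Suc j)
      have "(snorm \<omega> (w * E j))\<^sup>2 = Re (\<omega> (w * w * (E j * E j)))"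
        using Suc.prems by (simp add: snorm_square[OF \<omega>] star_mult_comm w Eh ac)
      moreover have "w * w * (S * E 0 - S * E (Suc j)) = w * w * (S * E 0 - S * E j) + w * w * (E j * E j)"
        using Suc.prems by (simp add: rec right_diff_distrib)
      ultimately show ?case
        using Suc by (simp add: om_add[OF \<omega>])
    qed
    have "S * (S - E 0) + S * E n \<in> Pos"
      using Pos_add[OF Pos_herm_conj[OF s pos'[of 0]] Pos_herm_conj[OF s pos[of n]]]
      by (simp add: S_def)
    then have "w * w * (S * (S - E 0) + S * E n) \<in> Pos"
      by (intro Pos_herm_conj w)
    moreover have "w * w * (S * (S - E 0) + S * E n) = (w * S) * (w * S) - w * w * (S * E 0 - S * E n)"
      by (simp add: right_diff_distrib distrib_left ac)
    ultimately have sum_le: "(\<Sum>i<n. (snorm \<omega> (w * E i))\<^sup>2) \<le> (snorm \<omega> (w * S))\<^sup>2"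
      using om_Re_pos[OF \<omega>, of "w * w * (S * (S - E 0) + S * E n)"] sum_eq[of n]
      by (simp add: om_diff[OF \<omega>] snorm_square[OF \<omega>] star_mult_comm w S)
    \<comment> \<open>Pigeonhole: some remainder is small.\<close>
    obtain i where i: "i < n" and "(snorm \<omega> (w * E i))\<^sup>2 \<le> (snorm \<omega> (w * S))\<^sup>2 / real n"
    proof (rule ccontr)
      assume "\<not> thesis"
      with that have "\<And>i. i < n \<Longrightarrow> (snorm \<omega> (w * S))\<^sup>2 / real n < (snorm \<omega> (w * E i))\<^sup>2"
        by (meson not_le)
      then have "(\<Sum>i<n. (snorm \<omega> (w * S))\<^sup>2 / real n) < (\<Sum>i<n. (snorm \<omega> (w * E i))\<^sup>2)"
        using n by (intro sum_strict_mono) auto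
      with sum_le n show False by simp
    qed
    then have "(snorm \<omega> (w * E i))\<^sup>2 \<le> (snorm \<omega> (w * S) * \<delta>)\<^sup>2"
      by (simp add: n_def \<delta>_def power_mult_distrib power_divide)
    then have wE: "snorm \<omega> (w * E i) \<le> snorm \<omega> (w * S) * \<delta>"
      using \<delta> snorm_nonneg[OF \<omega>] by (meson less_imp_le mult_nonneg_nonneg power2_le_imp_le)
    have "snorm \<omega> (w * S) \<le> snorm \<omega> (r * r) + \<delta>"
    proof -
      have "r * r - w * S = r * r * h"
        by (simp add: w_def h_def v_def right_diff_distrib ac)
      then show ?thesis
        using snorm_diff_le[OF \<omega>, of "w * S" "r * r"] small(3) by simp
    qed
    then have wE': "snorm \<omega> (w * E i) \<le> (snorm \<omega> (r * r) + 1) * \<delta>"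
      using wE \<delta> by (smt (verit) mult_right_mono)
    have xv: "snorm \<omega> (x * v) \<le> snorm \<omega> x + 1"
    proof -
      have "x - x * v = x * h" by (simp add: h_def right_diff_distrib)
      then show ?thesis
        using snorm_diff_le[OF \<omega>, of "x * v" x] small(2) \<delta> by simp
    qed
    define d where "d = c * r"
    have d: "d\<^sup>\<star> = d" unfolding d_def by (rule herm_mult[OF c rh])
    have partial: "0 \<le> Re (\<omega> (d * d * (S * E 0 - S * E j) * x))" if "j \<le> n" for j
      using that
    proof (induction j)
      case 0
      show ?case by (simp add: om_zero[OF \<omega>])
    next
      case (Suc j)
      have "(d * E j) * (d * E j) * x \<in> Pos"
        using Suc.prems by (intro Pos_herm_conj x herm_mult d Eh) simp
      moreover have "d * d * (S * E 0 - S * E (Suc j)) * x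
          = d * d * (S * E 0 - S * E j) * x + (d * E j) * (d * E j) * x"
        using Suc.prems by (simp add: rec right_diff_distrib left_diff_distrib ac)
      ultimately show ?case
        using Suc om_Re_pos[OF \<omega>] by (simp add: om_add[OF \<omega>])
    qed
    have split: "v * v * (a * x) = d * d * (S * E 0 - S * E i) * x + (x * v) * (w * E i)"
    proof -
      have "v * v * (a * x) = c * c * S * (S * a) * x"
        by (simp add: v_def ac)
      also have "\<dots> = d * d * (S * E 0) * x"
        unfolding Sa by (simp add: d_def ac)
      also have "\<dots> = d * d * (S * E 0 - S * E i) * x + d * d * (S * E i) * x"
        by (simp add: right_diff_distrib left_diff_distrib)
      also have "d * d * (S * E i) * x = (x * v) * (w * E i)"
        by (simp add: d_def v_def w_def ac)
      finally show ?thesis .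
    qed
    have cross: "cmod (\<omega> ((x * v) * (w * E i))) \<le> (snorm \<omega> x + 1) * ((snorm \<omega> (r * r) + 1) * \<delta>)"
      using cauchy_schwarz_mult[OF \<omega>, of "x * v" "w * E i"] xv wE' snorm_nonneg[OF \<omega>]
      by (meson mult_mono order_trans snorm_nonneg[OF \<omega>] add_nonneg_nonneg zero_le_one)
    have main: "- ((snorm \<omega> x + 1) * ((snorm \<omega> (r * r) + 1) * \<delta>)) \<le> Re (\<omega> (v * v * (a * x)))"
      using partial[of i] i cross abs_Re_le_cmod[of "\<omega> ((x * v) * (w * E i))"]
      unfolding split by (simp add: om_add[OF \<omega>])
    \<comment> \<open>Going back from the translated functional: \<open>1 - v\<^sup>2 = 2 * h - h\<^sup>2\<close>.\<close>
    have "a * x = v * v * (a * x) + (h * (a * x) + h * (a * x)) - (a * h) * (x * h)"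
      by (simp add: h_def right_diff_distrib left_diff_distrib ac)
    then have "\<omega> (a * x) = \<omega> (v * v * (a * x)) + (\<omega> (h * (a * x)) + \<omega> (h * (a * x))) - \<omega> ((a * h) * (x * h))"
      by (metis om_add[OF \<omega>] om_diff[OF \<omega>])
    moreover have "cmod (\<omega> (h * (a * x))) \<le> \<delta> * snorm \<omega> (a * x)"
      using cauchy_schwarz_mult[OF \<omega>, of h "a * x"] small(1) snorm_nonneg[OF \<omega>]
      by (meson mult_right_mono order_trans)
    moreover have "cmod (\<omega> ((a * h) * (x * h))) \<le> \<delta>"
    proof -
      have "cmod (\<omega> ((a * h) * (x * h))) \<le> \<delta> * \<delta>"
        using cauchy_schwarz_mult[OF \<omega>, of "a * h" "x * h"] small \<delta> snorm_nonneg[OF \<omega>]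
        by (meson mult_mono order_trans less_imp_le)
      also have "\<dots> \<le> \<delta>" using \<delta> by (simp add: mult_left_le)
      finally show ?thesis .
    qed
    moreover note main abs_Re_le_cmod[of "\<omega> (h * (a * x))"] abs_Re_le_cmod[of "\<omega> ((a * h) * (x * h))"]
    moreover have "Re (\<omega> (a * x)) = Re (\<omega> (v * v * (a * x)))
        + (Re (\<omega> (h * (a * x))) + Re (\<omega> (h * (a * x)))) - Re (\<omega> ((a * h) * (x * h)))"
      using calculation(1) by simp
    ultimately have "- ((snorm \<omega> x + 1) * ((snorm \<omega> (r * r) + 1) * \<delta>)) - 2 * (\<delta> * snorm \<omega> (a * x)) - \<delta>
        \<le> Re (\<omega> (a * x))"
      by linarith
    then show ?thesis
      unfolding \<delta>_def[symmetric] C_def by (simp add: algebra_simps)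
  qed
  have "(\<lambda>N. - C * (1 / real (Suc N))) \<longlonglongrightarrow> - C * 0"
    by (intro tendsto_mult tendsto_const) (use LIMSEQ_inverse_real_of_nat in \<open>simp add: inverse_eq_divide\<close>)
  from LIMSEQ_le_const2[OF this, of "Re (\<omega> (a * x))"] bound show ?thesis
    by auto
qed

lemma dual_posI:
  assumes "\<omega> \<in> dual" "\<And>a. \<omega> (a\<^sup>\<star>) = cnj (\<omega> a)" "\<And>a. a \<in> Pos \<Longrightarrow> 0 \<le> Re (\<omega> a)"
  shows "\<omega> \<in> dual_pos le"
proof -
  have "dual_star \<omega> = \<omega>"
    using assms(2)[symmetric] by (simp add: dual_star_def fun_eq_iff star_star)
  moreover have "0 \<le> \<omega> a" if "a \<in> Pos" for a
    using assms(2)[of a] assms(3)[OF that] Pos_star[OF that]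
    by (metis complex_cnj Reals_cnj_iff complex_is_Real_iff less_eq_complex_def zero_complex.sel)
  ultimately show ?thesis
    using assms(1) by (simp add: dual_pos_def dual_hermitian_def dual_le_def)
qed

end

locale commutative_stieltjes_Ostar = commutative_Ostar +
  fixes Q' :: "'a set"
  assumes down_closed: "downwards_closed le \<Omega>"
    and gen_nonempty: "Q' \<noteq> {}"
    and gen_coercive: "q \<in> Q' \<Longrightarrow> coercive le q"
    and gen_stieltjes: "\<omega> \<in> states le \<Omega> \<Longrightarrow> q \<in> Q' \<Longrightarrow> stieltjes_state le \<Omega> q \<omega>"
    and strongly_dense: "pos_elems le \<subseteq> strong_topology le \<Omega> closure_of
            (down_algebra le (constructed_dominant_set Q') \<inter> pos_elems le)"
begin

abbreviation "Q \<equiv> constructed_dominant_set Q'"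
abbreviation "D \<equiv> down_algebra le Q \<inter> Pos"

lemma strong_approx:
  assumes "a \<in> Pos" and \<omega>: "\<omega> \<in> Om" and "0 < e"
  obtains y where "y \<in> D" "snorm \<omega> (y - a) < e"
proof -
  define B where "B = {y. snorm \<omega> (y - a) < e}"
  have "openin (strong_topology le \<Omega>) B"
    unfolding strong_topology_def B_def using assms by (intro topology_generated_by_Basis) blast
  moreover have "a \<in> B"
    using \<open>0 < e\<close> by (simp add: B_def strong_seminorm_def om_zero[OF \<omega>])
  moreover have "a \<in> strong_topology le \<Omega> closure_of D"
    using assms strongly_dense by blast
  ultimately obtain y where "y \<in> D" "y \<in> B"
    unfolding in_closure_of by blast
  then show ?thesis using that by (auto simp: B_def)
qed

definition square_coercive :: "'a \<Rightarrow> bool" where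
  "square_coercive q \<longleftrightarrow> q\<^sup>\<star> = q \<and> (\<exists>e>0. q * q - e *\<^sub>r 1 \<in> Pos)"

lemma gen_facts:
  assumes "q \<in> Q'" shows "dense_range q \<and> square_coercive q"
proof
  show "dense_range q"
    using assms gen_coercive gen_stieltjes by (intro stieltjes_dense_range)
  obtain \<epsilon> where \<epsilon>: "0 < \<epsilon>" and qP: "q \<in> Pos" and q\<epsilon>: "q - \<epsilon> *\<^sub>r 1 \<in> Pos"
    using coerciveE[OF gen_coercive[OF assms]] .
  define d where "d = q - \<epsilon> *\<^sub>r 1"
  have q: "q = d + \<epsilon> *\<^sub>r 1" by (simp add: d_def)
  have "d * d + (2 * \<epsilon>) *\<^sub>r d \<in> Pos"
    using q\<epsilon> \<epsilon> unfolding d_def[symmetric]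
    by (intro Pos_add Pos_square Pos_scale Pos_star) auto
  moreover have "q * q - (\<epsilon> * \<epsilon>) *\<^sub>r 1 = d * d + (2 * \<epsilon>) *\<^sub>r d"
  proof -
    have "(2 * \<epsilon>) *\<^sub>r d = \<epsilon> *\<^sub>r d + \<epsilon> *\<^sub>r d"
      by (simp add: scaleC_add_left[symmetric])
    then show ?thesis
      unfolding q by (simp add: distrib_left distrib_right mult_scaleC_left mult_scaleC_right scaleC_scaleC
          scaleC_add_right)
  qed
  ultimately show "square_coercive q"
    using \<epsilon> Pos_star[OF qP] unfolding square_coercive_def by (metis mult_pos_pos)
qed

lemma square_coercive_mult:
  assumes q: "square_coercive q" and r: "square_coercive r"
  shows "square_coercive (q * r)"
proof -
  obtain e f where e: "0 < e" "q * q - e *\<^sub>r 1 \<in> Pos" and f: "0 < f" "r * r - f *\<^sub>r 1 \<in> Pos"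
    using q r unfolding square_coercive_def by blast
  have h: "q\<^sup>\<star> = q" "r\<^sup>\<star> = r" using q r by (auto simp: square_coercive_def)
  have "q * q * (r * r - f *\<^sub>r 1) + f *\<^sub>r (q * q - e *\<^sub>r 1) \<in> Pos"
    using e f by (intro Pos_add Pos_herm_conj Pos_scale h) auto
  moreover have "q * q * (r * r - f *\<^sub>r 1) + f *\<^sub>r (q * q - e *\<^sub>r 1) = (q * r) * (q * r) - (f * e) *\<^sub>r 1"
    by (simp add: right_diff_distrib mult_scaleC_right scaleC.scale_right_diff_distrib scaleC_scaleC ac)
  ultimately show ?thesis
    unfolding square_coercive_def using e f h by (metis herm_mult mult_pos_pos)
qed

lemma square_coercive_one: "square_coercive 1"
  unfolding square_coercive_def by (auto intro!: exI[of _ 1] simp: scaleC_one Pos_zero)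

lemma prod_list_facts:
  "set qs \<subseteq> Q' \<Longrightarrow> dense_range (prod_list qs) \<and> square_coercive (prod_list qs)"
  by (induction qs)
    (auto simp: dense_range_one square_coercive_one gen_facts dense_range_mult square_coercive_mult)

lemma dominant_facts:
  assumes "r \<in> Q" shows "dense_range r \<and> square_coercive r"
proof -
  obtain t qs where t: "1 \<le> t" and qs: "set qs \<subseteq> Q'" and r: "r = t *\<^sub>r prod_list qs"
    using assms unfolding constructed_dominant_set_def by blast
  define p where "p = prod_list qs"
  have p: "dense_range p" "square_coercive p"
    using prod_list_facts[OF qs] by (auto simp: p_def)
  then obtain e where e: "0 < e" "p * p - e *\<^sub>r 1 \<in> Pos" and ph: "p\<^sup>\<star> = p"
    unfolding square_coercive_def by blast
  have "1 \<le> t * t" using mult_mono[of 1 t 1 t] t by simp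
  then have "(t * t - 1) *\<^sub>r (p * p) + (p * p - e *\<^sub>r 1) \<in> Pos"
    using e ph by (intro Pos_add Pos_scale Pos_square) auto
  moreover have "(t * t - 1) *\<^sub>r (p * p) + (p * p - e *\<^sub>r 1) = r * r - e *\<^sub>r 1"
    by (simp add: r p_def[symmetric] scaleC.scale_left_diff_distrib mult_scaleC_left mult_scaleC_right
        scaleC_scaleC scaleC_one)
  ultimately have "r * r - e *\<^sub>r 1 \<in> Pos"
    by (simp only:)
  moreover have "r\<^sup>\<star> = r"
    by (simp add: r p_def[symmetric] star_scaleC ph)
  moreover have "dense_range r"
    unfolding r p_def[symmetric] using t by (intro dense_range_scale p) auto
  ultimately show ?thesis
    using e unfolding square_coercive_def by auto
qed

lemma dominant_scale:
  assumes "r \<in> Q" "1 \<le> t" shows "t *\<^sub>r r \<in> Q"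
proof -
  obtain u qs where "1 \<le> u" "qs \<noteq> []" "set qs \<subseteq> Q'" and r: "r = u *\<^sub>r prod_list qs"
    using assms unfolding constructed_dominant_set_def by blast
  moreover have "t *\<^sub>r r = (t * u) *\<^sub>r prod_list qs"
    by (simp add: r scaleC_scaleC)
  moreover have "1 \<le> t * u"
    using \<open>1 \<le> t\<close> \<open>1 \<le> u\<close> mult_mono[of 1 t 1 u] by simp
  ultimately show ?thesis
    unfolding constructed_dominant_set_def by blast
qed

lemma dominant_nonempty: "\<exists>q. q \<in> Q"
proof -
  obtain q where "q \<in> Q'" using gen_nonempty by blast
  then have "1 *\<^sub>r prod_list [q] \<in> Q"
    unfolding constructed_dominant_set_def mem_Collect_eq
    by (intro exI[of _ 1] exI[of _ "[q]"]) simp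
  then show ?thesis by blast
qed

text \<open>
  The elements of \<open>Q\<^sup>\<down>\<close> are bounded in the form needed for the Riesz argument:
  \<open>2 * a \<le> a\<^sup>2 + 1\<close>, and both summands are dominated by multiples of \<open>r\<^sup>2\<close> because \<open>q\<^sup>2\<close> and \<open>r\<^sup>2\<close> are
  coercive.
\<close>

lemma down_le_square:
  assumes "a \<in> D"
  obtains r where "r \<in> Q" "r * r - a \<in> Pos"
proof -
  have a: "a \<in> Pos" "a\<^sup>\<star> = a" using assms by (auto intro: Pos_star)
  obtain q where q: "q \<in> Q" using dominant_nonempty by blast
  then obtain r where r: "r \<in> Q" and le: "le (a\<^sup>\<star> * q ^ 2 * a) (r ^ 2)"
    using assms unfolding down_algebra_def by blast
  obtain e f where e: "0 < e" "q * q - e *\<^sub>r 1 \<in> Pos" and f: "0 < f" "r * r - f *\<^sub>r 1 \<in> Pos"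
    using dominant_facts[OF q] dominant_facts[OF r] unfolding square_coercive_def by blast
  have rh: "r\<^sup>\<star> = r" using dominant_facts[OF r] unfolding square_coercive_def by blast
  have "r * r - a * (q * q) * a \<in> Pos"
    using le a by (simp add: le_iff power2_eq_square)
  then have 1: "r * r - a * a * (q * q) \<in> Pos"
    by (simp add: ac)
  have 2: "a * a * (q * q - e *\<^sub>r 1) \<in> Pos"
    using e by (intro Pos_herm_conj a)
  have 3: "(a - 1) * (a - 1) \<in> Pos"
    using a by (intro Pos_square) (simp add: star_diff)
  \<comment> \<open>The summand \<open>1\<close> puts the factor into \<open>[1, \<infinity>)\<close>, where also \<open>K \<le> K\<^sup>2\<close>.\<close>
  define K where "K = 1 / e + 1 / f + 1"
  have K: "1 \<le> K" using e f by (simp add: K_def)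
  have "(K *\<^sub>r r) * (K *\<^sub>r r) - a \<in> Pos"
    unfolding Pos_iff
  proof (intro conjI ballI)
    show "((K *\<^sub>r r) * (K *\<^sub>r r) - a)\<^sup>\<star> = (K *\<^sub>r r) * (K *\<^sub>r r) - a"
      using a by (simp add: star_diff star_mult_comm star_scaleC rh)
    fix \<omega> assume \<omega>: "\<omega> \<in> Om"
    define R where "R = Re (\<omega> (r * r))"
    define A2 where "A2 = Re (\<omega> (a * a))"
    have 4: "e * A2 \<le> R"
      using om_Re_pos[OF \<omega> 1] om_Re_pos[OF \<omega> 2]
      by (simp add: right_diff_distrib om_diff[OF \<omega>] mult_scaleC_right om_scale[OF \<omega>] R_def A2_def)
    have 5: "f * Re (\<omega> 1) \<le> R"
      using om_Re_pos[OF \<omega> f(2)] by (simp add: om_diff[OF \<omega>] om_scale[OF \<omega>] R_def)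
    have 6: "2 * Re (\<omega> a) \<le> A2 + Re (\<omega> 1)"
      using om_Re_pos[OF \<omega> 3]
      by (simp add: right_diff_distrib left_diff_distrib om_diff[OF \<omega>] A2_def)
    have R: "0 \<le> R" unfolding R_def by (intro om_Re_pos[OF \<omega>] Pos_square rh)
    have "A2 \<le> R / e" "Re (\<omega> 1) \<le> R / f"
      using 4 5 e f by (simp_all add: pos_le_divide_eq mult.commute)
    with 6 have "2 * Re (\<omega> a) \<le> R / e + R / f"
      by linarith
    also have "\<dots> \<le> K * R"
      using R by (simp add: K_def algebra_simps)
    also have "\<dots> \<le> K * K * R"
      using R K by (intro mult_right_mono) auto
    finally have "2 * Re (\<omega> a) \<le> K * K * R" .
    moreover have "0 \<le> Re (\<omega> a)" by (intro om_Re_pos[OF \<omega>] a)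
    ultimately show "0 \<le> Re (\<omega> ((K *\<^sub>r r) * (K *\<^sub>r r) - a))"
      by (simp add: om_diff[OF \<omega>] mult_scaleC_right mult_scaleC_left scaleC_scaleC om_scale[OF \<omega>] R_def mult_ac)
  qed
  then show ?thesis
    using that dominant_scale[OF r K] by blast
qed

text \<open>
  The heart of the matter. In a commutative ordered *-algebra products of positive elements need
  not be positive: take the polynomials in \<open>x\<close> and \<open>y\<close> with the positive elements
  \<open>s + x * t + y * u\<close>, where \<open>s\<close>, \<open>t\<close>, \<open>u\<close> are sums of squares; then \<open>x * y\<close> is not positive. Here
  strong density reduces the claim to the positive elements of \<open>Q\<^sup>\<down>\<close>, which are bounded by squares
  from the dominant set.
\<close>

lemma Pos_mult:
  assumes a: "a \<in> Pos" and x: "x \<in> Pos"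
  shows "a * x \<in> Pos"
  unfolding Pos_iff
proof (intro conjI ballI)
  show "(a * x)\<^sup>\<star> = a * x"
    using a x by (intro herm_mult Pos_star)
  fix \<omega> assume \<omega>: "\<omega> \<in> Om"
  have N: "0 \<le> snorm \<omega> x" by (rule snorm_nonneg[OF \<omega>])
  show "0 \<le> Re (\<omega> (a * x))"
  proof (rule field_le_epsilon)
    fix d :: real assume d: "0 < d"
    define e where "e = d / (snorm \<omega> x + 1)"
    have e: "0 < e" using d N by (simp add: e_def)
    obtain y where y: "y \<in> D" "snorm \<omega> (y - a) < e"
      using strong_approx[OF a \<omega> e] .
    obtain r where r: "r \<in> Q" "r * r - y \<in> Pos"
      using down_le_square[OF y(1)] .
    have "0 \<le> Re (\<omega> (y * x))"
      using r y dominant_facts by (intro mult_nonneg_of_square_bound[OF _ _ _ x \<omega>]) auto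
    moreover have "cmod (\<omega> ((y - a) * x)) \<le> e * snorm \<omega> x"
      using cauchy_schwarz_mult[OF \<omega>, of "y - a" x] y(2) N
      by (meson less_imp_le mult_right_mono order_trans)
    moreover have "e * snorm \<omega> x \<le> e * (snorm \<omega> x + 1)" using e by simp
    moreover have "e * (snorm \<omega> x + 1) = d" using N by (simp add: e_def)
    moreover have "Re (\<omega> ((y - a) * x)) = Re (\<omega> (y * x)) - Re (\<omega> (a * x))"
      by (simp add: left_diff_distrib om_diff[OF \<omega>])
    ultimately show "0 \<le> Re (\<omega> (a * x)) + d"
      using abs_Re_le_cmod[of "\<omega> ((y - a) * x)"] by linarith
  qed
qed

end

section \<open>Pure states and characters\<close>

context commutative_Ostar
begin

text \<open>
  Extremality in its usual working form. To avoid the degenerate cases in which one of the two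
  summands vanishes, \<open>\<rho> + \<omega>\<close> and \<open>(K + 1) \<omega> - \<rho>\<close> are normalized instead of \<open>\<rho>\<close> and \<open>K \<omega> - \<rho>\<close>; both
  have value at least \<open>1\<close> at the unit.
\<close>

lemma pure_dominated:
  assumes \<omega>: "\<omega> \<in> pure_states le \<Omega>" and \<rho>: "\<rho> \<in> Om"
    and dom: "\<And>x. x \<in> Pos \<Longrightarrow> Re (\<rho> x) \<le> K * Re (\<omega> x)"
  shows "\<rho> x = \<rho> 1 * \<omega> x"
proof -
  have ext: "\<omega> extreme_point_of states le \<Omega>"
    using \<omega> by (simp add: pure_states_def)
  then have \<omega>O: "\<omega> \<in> Om" and \<omega>1: "\<omega> 1 = 1"
    by (auto simp: extreme_point_of_def states_def)
  define p where "p = Re (\<rho> 1)"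
  have \<rho>1: "\<rho> 1 = of_real p"
    using om_herm_real[OF \<rho>, of 1] by (simp add: p_def complex_eq_iff)
  have p: "0 \<le> p" "p \<le> K"
    using om_Re_pos[OF \<rho> Pos_one] dom[OF Pos_one] by (auto simp: p_def \<omega>1)
  define \<sigma>1 where "\<sigma>1 = scale_fun (of_real (1 / (p + 1))) (\<rho> + \<omega>)"
  define \<eta> where "\<eta> = scale_fun (of_real (K + 1)) \<omega> - \<rho>"
  define \<sigma>2 where "\<sigma>2 = scale_fun (of_real (1 / (K + 1 - p))) \<eta>"
  have "\<eta> \<in> Om"
  proof
    show "\<eta> \<in> \<Omega>"
      unfolding \<eta>_def using \<omega>O \<rho>
      by (intro scale_fun.subspace_diff scale_fun.subspace_scale Omega_subspace) auto
    show "\<eta> \<in> dual_pos le"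
    proof (rule dual_posI)
      show "\<eta> \<in> dual" using \<open>\<eta> \<in> \<Omega>\<close> Omega_dual by blast
      show "\<eta> (a\<^sup>\<star>) = cnj (\<eta> a)" for a
        by (simp add: \<eta>_def scale_fun_def om_star[OF \<omega>O] om_star[OF \<rho>])
      show "0 \<le> Re (\<eta> a)" if "a \<in> Pos" for a
        using dom[OF that] om_Re_pos[OF \<omega>O that] by (simp add: \<eta>_def scale_fun_def algebra_simps)
    qed
  qed
  have "\<sigma>1 \<in> states le \<Omega>"
    using om_scale_fun[OF om_sum[OF \<rho> \<omega>O], of "1 / (p + 1)"] p
    by (simp add: states_def \<sigma>1_def scale_fun_def \<rho>1 \<omega>1 del: of_real_add)
      (simp add: complex_eq_iff)
  moreover have "\<sigma>2 \<in> states le \<Omega>"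
    using om_scale_fun[OF \<open>\<eta> \<in> Om\<close>, of "1 / (K + 1 - p)"] p
    by (simp add: states_def \<sigma>2_def \<eta>_def scale_fun_def \<rho>1 \<omega>1)
      (simp add: complex_eq_iff)
  ultimately have not_seg: "\<omega> \<notin> open_segment \<sigma>1 \<sigma>2"
    using ext by (simp add: extreme_point_of_def)
  define t where "t = (K + 1 - p) / (K + 2)"
  have t: "0 < t" "t < 1" using p by (simp_all add: t_def)
  have t': "1 - t = (p + 1) / (K + 2)" using p by (simp add: t_def field_simps)
  have comb: "\<omega> = (1 - t) *\<^sub>R \<sigma>1 + t *\<^sub>R \<sigma>2"
  proof
    fix y
    have "(1 - t) * (1 / (p + 1)) = 1 / (K + 2)"
      using p by (simp add: t')
    moreover have "t * (1 / (K + 1 - p)) = 1 / (K + 2)"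
      using p by (simp add: t_def)
    ultimately have "((1 - t) *\<^sub>R \<sigma>1 + t *\<^sub>R \<sigma>2) y
        = of_real (1 / (K + 2)) * (\<rho> y + \<omega> y) + of_real (1 / (K + 2)) * (of_real (K + 1) * \<omega> y - \<rho> y)"
      by (simp only: plus_fun_def scaleR_fun_def \<sigma>1_def \<sigma>2_def \<eta>_def scale_fun_def scaleR_conv_of_real
          minus_apply mult.assoc[symmetric] of_real_mult[symmetric] fun_diff_def)
    also have "\<dots> = of_real (1 / (K + 2)) * of_real (K + 2) * \<omega> y"
    proof -
      have "b * (\<rho> y + \<omega> y) + b * (of_real (K + 1) * \<omega> y - \<rho> y) = b * of_real (K + 2) * \<omega> y" for b
        by (simp add: algebra_simps)
      then show ?thesis .
    qed
    also have "\<dots> = \<omega> y"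
      using p unfolding of_real_mult[symmetric] by simp
    finally show "\<omega> y = ((1 - t) *\<^sub>R \<sigma>1 + t *\<^sub>R \<sigma>2) y" by simp
  qed
  with not_seg t have "\<sigma>1 = \<sigma>2"
    unfolding in_segment by blast
  with comb have "\<omega> = \<sigma>1"
    by (simp add: scaleR_left_distrib[symmetric])
  then have "\<omega> x = of_real (1 / (p + 1)) * (\<rho> x + \<omega> x)"
    unfolding \<sigma>1_def scale_fun_def plus_fun_def by metis
  then have "of_real (p + 1) * \<omega> x = of_real ((p + 1) * (1 / (p + 1))) * (\<rho> x + \<omega> x)"
    by (simp only: of_real_mult mult.assoc)
  then show ?thesis
    using p by (simp add: \<rho>1 algebra_simps)
qed

text \<open>
  A multiplicative \<open>\<omega>\<close> has variance zero on \<open>v = a - \<omega>(a) 1\<close>; hence so have all states of which \<open>\<omega>\<close>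
  is a proper convex combination.
\<close>

lemma character_is_pure:
  assumes "\<omega> \<in> characters le \<Omega>" shows "\<omega> \<in> pure_states le \<Omega>"
proof -
  have \<omega>: "\<omega> \<in> states le \<Omega>" and mult: "\<And>a b. \<omega> (a * b) = \<omega> a * \<omega> b"
    using assms by (auto simp: characters_def)
  then have \<omega>O: "\<omega> \<in> Om" and \<omega>1: "\<omega> 1 = 1" by (auto simp: states_def)
  have "\<omega> \<notin> open_segment \<sigma> \<rho>" if \<sigma>: "\<sigma> \<in> states le \<Omega>" and \<rho>: "\<rho> \<in> states le \<Omega>" for \<sigma> \<rho>
  proof
    assume "\<omega> \<in> open_segment \<sigma> \<rho>"
    then obtain t where "\<sigma> \<noteq> \<rho>" and t: "0 < t" "t < 1" and comb: "\<omega> = (1 - t) *\<^sub>R \<sigma> + t *\<^sub>R \<rho>"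
      unfolding in_segment by blast
    have \<sigma>O: "\<sigma> \<in> Om" "\<sigma> 1 = 1" and \<rho>O: "\<rho> \<in> Om" "\<rho> 1 = 1"
      using \<sigma> \<rho> by (auto simp: states_def)
    have "\<sigma> a = \<omega> a \<and> \<rho> a = \<omega> a" for a
    proof -
      define v where "v = a - \<omega> a *\<^sub>C 1"
      have "\<omega> v = 0"
        by (simp add: v_def om_diff[OF \<omega>O] om_scale[OF \<omega>O] \<omega>1)
      then have "\<omega> (v\<^sup>\<star> * v) = 0" by (simp add: mult)
      then have "(1 - t) * Re (\<sigma> (v\<^sup>\<star> * v)) + t * Re (\<rho> (v\<^sup>\<star> * v)) = 0"
        using comb by (simp add: scaleR_fun_def complex_eq_iff)
      moreover have "0 \<le> Re (\<sigma> (v\<^sup>\<star> * v))" "0 \<le> Re (\<rho> (v\<^sup>\<star> * v))"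
        by (intro om_Re_pos \<sigma>O \<rho>O Pos_star_square)+
      ultimately have "Re (\<sigma> (v\<^sup>\<star> * v)) = 0" "Re (\<rho> (v\<^sup>\<star> * v)) = 0"
        using t by (smt (verit) mult_nonneg_nonneg mult_pos_pos)+
      then have "snorm \<sigma> v = 0" "snorm \<rho> v = 0"
        by (simp_all add: strong_seminorm_def)
      then have "\<sigma> v = 0" "\<rho> v = 0"
        using cauchy_schwarz_mult[OF \<sigma>O(1), of 1 v] cauchy_schwarz_mult[OF \<rho>O(1), of 1 v] by simp_all
      then show ?thesis
        by (simp add: v_def om_diff[OF \<sigma>O(1)] om_scale[OF \<sigma>O(1)] om_diff[OF \<rho>O(1)]
            om_scale[OF \<rho>O(1)] \<sigma>O \<rho>O)
    qed
    then have "\<sigma> = \<rho>" by (auto simp: fun_eq_iff)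
    with \<open>\<sigma> \<noteq> \<rho>\<close> show False ..
  qed
  with \<omega> show ?thesis
    by (simp add: pure_states_def extreme_point_of_def)
qed

lemma coercive_square_bound:
  assumes \<omega>: "\<omega> \<in> Om" and q: "q\<^sup>\<star> = q" and f: "0 < f" "q * q - f *\<^sub>r 1 \<in> Pos"
  shows "snorm \<omega> c \<le> snorm \<omega> (q * c) / sqrt f"
proof -
  have "c\<^sup>\<star> * (q * q - f *\<^sub>r 1) * c \<in> Pos"
    by (intro Pos_conj f)
  moreover have "c\<^sup>\<star> * (q * q - f *\<^sub>r 1) * c = (q * c)\<^sup>\<star> * (q * c) - f *\<^sub>r (c\<^sup>\<star> * c)"
    by (simp add: star_mult_comm q right_diff_distrib left_diff_distrib mult_scaleC_left mult_scaleC_right ac)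
  ultimately have "f * (snorm \<omega> c)\<^sup>2 \<le> (snorm \<omega> (q * c))\<^sup>2"
    using om_Re_pos[OF \<omega>, of "c\<^sup>\<star> * (q * q - f *\<^sub>r 1) * c"]
    by (simp add: om_diff[OF \<omega>] om_scale[OF \<omega>] snorm_square[OF \<omega>])
  then have "(sqrt f * snorm \<omega> c)\<^sup>2 \<le> (snorm \<omega> (q * c))\<^sup>2"
    using f by (simp add: power_mult_distrib)
  then have "sqrt f * snorm \<omega> c \<le> snorm \<omega> (q * c)"
    using snorm_nonneg[OF \<omega>] by (meson power2_le_imp_le)
  then show ?thesis
    using f by (simp add: field_simps)
qed

lemma approximate_inverse_sequence:
  assumes q: "dense_range q" and \<tau>: "\<tau> \<in> Om"
  obtains d where "\<And>n. (d n)\<^sup>\<star> = d n" "(\<lambda>n. snorm \<tau> (1 - q * d n)) \<longlonglongrightarrow> 0"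
proof -
  have "\<exists>c. c\<^sup>\<star> = c \<and> snorm \<tau> (1 - q * c) < inverse (real (Suc n))" for n
    using q \<tau> unfolding dense_range_def by simp
  then obtain d where d: "\<And>n. (d n)\<^sup>\<star> = d n" "\<And>n. snorm \<tau> (1 - q * d n) < inverse (real (Suc n))"
    by metis
  have "(\<lambda>n. snorm \<tau> (1 - q * d n)) \<longlonglongrightarrow> 0"
    by (rule tendsto_sandwich[OF _ _ tendsto_const LIMSEQ_inverse_real_of_nat])
      (use d(2) snorm_nonneg[OF \<tau>] in \<open>auto intro!: always_eventually less_imp_le\<close>)
  with d(1) show ?thesis by (rule that)
qed

lemma om_mult_tendsto_zero:
  assumes \<omega>: "\<omega> \<in> Om" and h: "(\<lambda>n. snorm \<omega> (h n)) \<longlonglongrightarrow> 0" and b: "\<And>n. snorm \<omega> (b n) \<le> B"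
  shows "(\<lambda>n. \<omega> (h n * b n)) \<longlonglongrightarrow> 0"
proof (rule Lim_null_comparison)
  show "(\<lambda>n. snorm \<omega> (h n) * B) \<longlonglongrightarrow> 0"
    using tendsto_mult_left_zero[OF h] .
  show "\<forall>\<^sub>F n in sequentially. norm (\<omega> (h n * b n)) \<le> snorm \<omega> (h n) * B"
    using cauchy_schwarz_mult[OF \<omega>] b snorm_nonneg[OF \<omega>]
    by (auto intro!: always_eventually) (meson mult_left_mono order_trans)
qed

text \<open>
  The functional \<open>x \<mapsto> \<omega> (q\<inverse> * x)\<close>. It exists although \<open>q\<close> need not be invertible: if \<open>q * c n\<close> tends
  to \<open>1\<close>, then \<open>\<omega> (c n * x)\<close> converges, because coercivity of \<open>q\<close> makes \<open>c n\<close> a Cauchy sequence. Its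
  positivity on \<open>x\<close> is seen from a second approximating sequence, adapted to \<open>x\<close>, for which
  \<open>q * (d n)\<^sup>2 * x\<close> can replace \<open>d n * x\<close>. Downwards closedness puts the limit into \<open>\<Omega>\<close>.
\<close>

lemma inverse_functional:
  assumes closed: "downwards_closed le \<Omega>"
    and mult: "\<And>a b. a \<in> Pos \<Longrightarrow> b \<in> Pos \<Longrightarrow> a * b \<in> Pos"
    and q: "dense_range q" "q \<in> Pos"
    and e: "0 < e" "q - e *\<^sub>r 1 \<in> Pos" and f: "0 < f" "q * q - f *\<^sub>r 1 \<in> Pos"
    and \<omega>: "\<omega> \<in> Om"
  obtains \<rho> where "\<rho> \<in> Om" "\<And>x. x \<in> Pos \<Longrightarrow> Re (\<rho> x) \<le> 1 / e * Re (\<omega> x)"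
    "\<And>y. \<rho> (q * y) = \<omega> y"
proof -
  have qh: "q\<^sup>\<star> = q" using q(2) by (rule Pos_star)
  obtain c where c: "\<And>n. (c n)\<^sup>\<star> = c n" and lim_c: "(\<lambda>n. snorm \<omega> (1 - q * c n)) \<longlonglongrightarrow> 0"
    using approximate_inverse_sequence[OF q(1) \<omega>] by blast
  have diff_le: "cmod (\<omega> (a * x) - \<omega> (b * x))
      \<le> (snorm \<omega> (1 - q * a) + snorm \<omega> (1 - q * b)) / sqrt f * snorm \<omega> x" for a b x
  proof -
    have "q * (a - b) = (1 - q * b) + (- (1 - q * a))"
      by (simp add: right_diff_distrib)
    then have "snorm \<omega> (q * (a - b)) \<le> snorm \<omega> (1 - q * b) + snorm \<omega> (- (1 - q * a))"
      using snorm_triangle[OF \<omega>] by metis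
    also have "snorm \<omega> (- (1 - q * a)) = snorm \<omega> (1 - q * a)"
      using snorm_minus[of \<omega> 0 "1 - q * a"] by simp
    finally have "snorm \<omega> (q * (a - b)) / sqrt f \<le> (snorm \<omega> (1 - q * a) + snorm \<omega> (1 - q * b)) / sqrt f"
      using f by (intro divide_right_mono) auto
    then have "snorm \<omega> (a - b) \<le> (snorm \<omega> (1 - q * a) + snorm \<omega> (1 - q * b)) / sqrt f"
      using coercive_square_bound[OF \<omega> qh f, of "a - b"] by linarith
    then have "snorm \<omega> (a - b) * snorm \<omega> x \<le> (snorm \<omega> (1 - q * a) + snorm \<omega> (1 - q * b)) / sqrt f * snorm \<omega> x"
      by (intro mult_right_mono snorm_nonneg[OF \<omega>])
    moreover have "\<omega> (a * x) - \<omega> (b * x) = \<omega> ((a - b) * x)"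
      by (simp add: left_diff_distrib om_diff[OF \<omega>])
    ultimately show ?thesis
      using cauchy_schwarz_mult[OF \<omega>, of "a - b" x] by simp
  qed
  have "Cauchy (\<lambda>n. \<omega> (c n * x))" for x
  proof (rule CauchyI)
    fix \<delta> :: real assume \<delta>: "0 < \<delta>"
    have "(\<lambda>n. snorm \<omega> (1 - q * c n) / sqrt f * snorm \<omega> x) \<longlonglongrightarrow> 0 / sqrt f * snorm \<omega> x"
      using f by (intro tendsto_intros lim_c) auto
    then have "\<forall>\<^sub>F n in sequentially. snorm \<omega> (1 - q * c n) / sqrt f * snorm \<omega> x < \<delta> / 2"
      using \<delta> by (intro order_tendstoD(2)) auto
    then obtain M where M: "\<And>n. M \<le> n \<Longrightarrow> snorm \<omega> (1 - q * c n) / sqrt f * snorm \<omega> x < \<delta> / 2"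
      unfolding eventually_sequentially by blast
    show "\<exists>M. \<forall>m\<ge>M. \<forall>n\<ge>M. norm (\<omega> (c m * x) - \<omega> (c n * x)) < \<delta>"
    proof (intro exI[of _ M] allI impI)
      fix m n assume "M \<le> m" "M \<le> n"
      then show "norm (\<omega> (c m * x) - \<omega> (c n * x)) < \<delta>"
        using diff_le[of "c m" x "c n"] M[of m] M[of n]
        unfolding add_divide_distrib distrib_right by linarith
    qed
  qed
  then have "\<exists>l. (\<lambda>n. \<omega> (c n * x)) \<longlonglongrightarrow> l" for x
    using Cauchy_convergent convergent_def by blast
  then obtain \<rho> where \<rho>: "\<And>x. (\<lambda>n. \<omega> (c n * x)) \<longlonglongrightarrow> \<rho> x"
    by metis
  \<comment> \<open>The limit does not depend on the approximating sequence.\<close>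
  have \<rho>': "(\<lambda>n. \<omega> (d n * x)) \<longlonglongrightarrow> \<rho> x" if d: "(\<lambda>n. snorm \<omega> (1 - q * d n)) \<longlonglongrightarrow> 0" for d x
  proof -
    have "(\<lambda>n. \<omega> (d n * x) - \<omega> (c n * x)) \<longlonglongrightarrow> 0"
    proof (rule Lim_null_comparison)
      show "\<forall>\<^sub>F n in sequentially. norm (\<omega> (d n * x) - \<omega> (c n * x))
          \<le> (snorm \<omega> (1 - q * d n) + snorm \<omega> (1 - q * c n)) / sqrt f * snorm \<omega> x"
        using diff_le by (intro always_eventually allI)
      have "(\<lambda>n. (snorm \<omega> (1 - q * d n) + snorm \<omega> (1 - q * c n)) / sqrt f * snorm \<omega> x)
          \<longlonglongrightarrow> (0 + 0) / sqrt f * snorm \<omega> x"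
        using f by (intro tendsto_intros lim_c d) auto
      then show "(\<lambda>n. (snorm \<omega> (1 - q * d n) + snorm \<omega> (1 - q * c n)) / sqrt f * snorm \<omega> x) \<longlonglongrightarrow> 0"
        by simp
    qed
    from tendsto_add[OF this \<rho>[of x]] show ?thesis by simp
  qed
  have \<rho>_dual: "\<rho> \<in> dual"
  proof (rule dualI)
    fix a b :: 'a and z :: complex
    have "(\<lambda>n. \<omega> (c n * (a + b))) \<longlonglongrightarrow> \<rho> a + \<rho> b"
      using tendsto_add[OF \<rho>[of a] \<rho>[of b]] by (simp add: distrib_left om_add[OF \<omega>])
    then show "\<rho> (a + b) = \<rho> a + \<rho> b"
      using \<rho> LIMSEQ_unique by blast
    have "(\<lambda>n. \<omega> (c n * (z *\<^sub>C a))) \<longlonglongrightarrow> z * \<rho> a"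
      using tendsto_mult_left[OF \<rho>[of a], of z] by (simp add: mult_scaleC_right om_scale[OF \<omega>])
    then show "\<rho> (z *\<^sub>C a) = z * \<rho> a"
      using \<rho> LIMSEQ_unique by blast
  qed
  have \<rho>_star: "\<rho> (a\<^sup>\<star>) = cnj (\<rho> a)" for a
  proof -
    have "\<omega> (c n * a\<^sup>\<star>) = cnj (\<omega> (c n * a))" for n
      using om_star[OF \<omega>, of "c n * a"] by (simp add: star_mult_comm c)
    then have "(\<lambda>n. \<omega> (c n * a\<^sup>\<star>)) \<longlonglongrightarrow> cnj (\<rho> a)"
      using tendsto_cnj[OF \<rho>[of a]] by simp
    then show ?thesis
      using \<rho> LIMSEQ_unique by blast
  qed
  have pos: "0 \<le> Re (\<rho> x) \<and> e * Re (\<rho> x) \<le> Re (\<omega> x)" if x: "x \<in> Pos" for x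
  proof -
    have xO: "x \<triangleright> \<omega> \<in> Om" by (rule om_conj_act[OF \<omega>])
    obtain d where d: "\<And>n. (d n)\<^sup>\<star> = d n"
      and lim: "(\<lambda>n. snorm (\<omega> + x \<triangleright> \<omega>) (1 - q * d n)) \<longlonglongrightarrow> 0"
      using approximate_inverse_sequence[OF q(1) om_sum[OF \<omega> xO]] by blast
    define h where "h n = 1 - q * d n" for n
    have lim_h: "(\<lambda>n. snorm \<omega> (h n)) \<longlonglongrightarrow> 0" "(\<lambda>n. snorm \<omega> (x * h n)) \<longlonglongrightarrow> 0"
      unfolding snorm_mult[of \<omega> x] h_def
      by (rule tendsto_sandwich[OF _ _ tendsto_const lim];
          use snorm_sum[OF \<omega> xO] snorm_nonneg[OF \<omega>] snorm_nonneg[OF xO] in \<open>auto intro!: always_eventually\<close>)+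
    obtain B where B: "\<And>n. snorm \<omega> (x * h n) \<le> B"
      using convergent_imp_Bseq[OF convergentI[OF lim_h(2)]] unfolding Bseq_def
      by (metis abs_le_D1 real_norm_def)
    have xd: "snorm \<omega> (x * d n) \<le> (snorm (x \<triangleright> \<omega>) 1 + B) / sqrt f" for n
    proof -
      have "snorm (x \<triangleright> \<omega>) (q * d n) \<le> snorm (x \<triangleright> \<omega>) 1 + snorm (x \<triangleright> \<omega>) (1 - q * d n)"
        by (rule snorm_diff_le[OF xO])
      also have "\<dots> \<le> snorm (x \<triangleright> \<omega>) 1 + B"
        using B[of n] by (simp add: snorm_mult[of \<omega> x] h_def)
      finally have "snorm (x \<triangleright> \<omega>) (q * d n) / sqrt f \<le> (snorm (x \<triangleright> \<omega>) 1 + B) / sqrt f"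
        using f by (intro divide_right_mono) auto
      then show ?thesis
        using coercive_square_bound[OF xO qh f, of "d n"] by (simp add: snorm_mult[of \<omega> x])
    qed
    have 1: "(\<lambda>n. \<omega> (q * (d n * d n * x))) \<longlonglongrightarrow> \<rho> x"
    proof -
      have "(\<lambda>n. \<omega> (d n * x) - \<omega> (h n * (x * d n))) \<longlonglongrightarrow> \<rho> x - 0"
        using lim_h(1) by (intro tendsto_diff \<rho>' om_mult_tendsto_zero[OF \<omega> _ xd]) (simp_all add: h_def)
      moreover have "\<omega> (d n * x) - \<omega> (h n * (x * d n)) = \<omega> (q * (d n * d n * x))" for n
      proof -
        have "d n * x - h n * (x * d n) = q * (d n * d n * x)"
          by (simp add: h_def left_diff_distrib right_diff_distrib ac)
        then show ?thesis by (metis om_diff[OF \<omega>])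
      qed
      ultimately show ?thesis by simp
    qed
    have 2: "(\<lambda>n. \<omega> (q * (q * (d n * d n * x)))) \<longlonglongrightarrow> \<omega> x"
    proof -
      have "(\<lambda>n. \<omega> x - (\<omega> (h n * x) + \<omega> (h n * x)) + \<omega> (h n * (x * h n))) \<longlonglongrightarrow> \<omega> x - (0 + 0) + 0"
        using lim_h(1) B by (intro tendsto_intros om_mult_tendsto_zero[OF \<omega>]) auto
      moreover have "\<omega> x - (\<omega> (h n * x) + \<omega> (h n * x)) + \<omega> (h n * (x * h n))
          = \<omega> (q * (q * (d n * d n * x)))" for n
      proof -
        have "x - (h n * x + h n * x) + h n * (x * h n) = q * (q * (d n * d n * x))"
          by (simp add: h_def left_diff_distrib right_diff_distrib ac)
        then show ?thesis by (metis om_diff[OF \<omega>] om_add[OF \<omega>])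
      qed
      ultimately show ?thesis by simp
    qed
    have dx: "d n * d n * x \<in> Pos" for n
      by (intro Pos_herm_conj d x)
    have "0 \<le> Re (\<rho> x)"
      using tendsto_Re[OF 1] by (rule LIMSEQ_le_const) (auto intro!: om_Re_pos[OF \<omega>] mult q dx)
    moreover have "e * Re (\<rho> x) \<le> Re (\<omega> x)"
    proof (rule LIMSEQ_le[OF tendsto_mult_left[OF tendsto_Re[OF 1], of e] tendsto_Re[OF 2]])
      have "e * Re (\<omega> (q * (d n * d n * x))) \<le> Re (\<omega> (q * (q * (d n * d n * x))))" for n
      proof -
        have "(q - e *\<^sub>r 1) * (q * (d n * d n * x)) \<in> Pos"
          by (intro mult e q dx)
        from om_Re_pos[OF \<omega> this] show ?thesis
          by (simp add: left_diff_distrib mult_scaleC_left om_diff[OF \<omega>] om_scale[OF \<omega>])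
      qed
      then show "\<exists>N. \<forall>n\<ge>N. e * Re (\<omega> (q * (d n * d n * x))) \<le> Re (\<omega> (q * (q * (d n * d n * x))))"
        by blast
    qed
    ultimately show ?thesis ..
  qed
  have \<rho>_pos: "\<rho> \<in> dual_pos le"
    using \<rho>_dual \<rho>_star pos by (intro dual_posI) auto
  define \<eta> where "\<eta> = scale_fun (complex_of_real (1 / e)) \<omega>"
  have \<eta>: "\<eta> \<in> Om"
    unfolding \<eta>_def using e by (intro om_scale_fun \<omega>) auto
  have "\<eta> - \<rho> \<in> dual_pos le"
  proof (rule dual_posI)
    show "\<eta> - \<rho> \<in> dual"
      by (rule dualI) (simp_all add: dual_add[OF \<rho>_dual] dual_scale[OF \<rho>_dual] om_add[OF \<eta>] om_scale[OF \<eta>]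
          algebra_simps)
    show "(\<eta> - \<rho>) (a\<^sup>\<star>) = cnj ((\<eta> - \<rho>) a)" for a
      by (simp add: \<rho>_star om_star[OF \<eta>])
    show "0 \<le> Re ((\<eta> - \<rho>) a)" if "a \<in> Pos" for a
      using pos[OF that] e by (simp add: \<eta>_def scale_fun_def field_simps)
  qed
  with closed \<eta> \<rho>_pos have "\<rho> \<in> Om"
    unfolding downwards_closed_def by blast
  moreover have "Re (\<rho> x) \<le> 1 / e * Re (\<omega> x)" if "x \<in> Pos" for x
    using pos[OF that] e by (simp add: field_simps)
  moreover have "\<rho> (q * y) = \<omega> y" for y
  proof -
    have "(\<lambda>n. \<omega> y - \<omega> ((1 - q * c n) * y)) \<longlonglongrightarrow> \<omega> y - 0"
      by (intro tendsto_intros om_mult_tendsto_zero[OF \<omega> lim_c order_refl])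
    moreover have "\<omega> y - \<omega> ((1 - q * c n) * y) = \<omega> (c n * (q * y))" for n
      by (simp add: right_diff_distrib om_diff[OF \<omega>] ac)
    ultimately have "(\<lambda>n. \<omega> (c n * (q * y))) \<longlonglongrightarrow> \<omega> y" by simp
    then show ?thesis
      using \<rho> LIMSEQ_unique by blast
  qed
  ultimately show ?thesis by (rule that)
qed

end

context commutative_stieltjes_Ostar
begin

definition factors :: "('a \<Rightarrow> complex) \<Rightarrow> 'a \<Rightarrow> bool" where
  "factors \<omega> a \<longleftrightarrow> (\<forall>y. \<omega> (a * y) = \<omega> a * \<omega> y)"

lemma pure_state_om:
  assumes "\<omega> \<in> pure_states le \<Omega>" shows "\<omega> \<in> Om" "\<omega> 1 = 1" "\<omega> \<in> states le \<Omega>"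
  using assms by (auto simp: pure_states_def extreme_point_of_def states_def)

text \<open>
  The functional \<open>x \<mapsto> \<omega> (q * x)\<close> need not be dominated by a multiple of \<open>\<omega>\<close>, but its counterpart
  with \<open>q\<inverse>\<close> is, and by purity it equals a multiple of \<open>\<omega>\<close>. Evaluating it at multiples of \<open>q\<close> gives
  the claim.
\<close>

lemma pure_factors_gen:
  assumes \<omega>: "\<omega> \<in> pure_states le \<Omega>" and q: "q \<in> Q'"
  shows "factors \<omega> q"
proof -
  note \<omega>O = pure_state_om[OF \<omega>]
  obtain e where e: "0 < e" and qP: "q \<in> Pos" and qe: "q - e *\<^sub>r 1 \<in> Pos"
    using coerciveE[OF gen_coercive[OF q]] .
  obtain f where f: "0 < f" "q * q - f *\<^sub>r 1 \<in> Pos" and dense: "dense_range q"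
    using gen_facts[OF q] unfolding square_coercive_def by blast
  obtain \<rho> where \<rho>: "\<rho> \<in> Om" and dom: "\<And>x. x \<in> Pos \<Longrightarrow> Re (\<rho> x) \<le> 1 / e * Re (\<omega> x)"
    and inv: "\<And>y. \<rho> (q * y) = \<omega> y"
    by (rule inverse_functional[OF down_closed Pos_mult dense qP e qe f \<omega>O(1)], assumption+, rule that)
  have \<rho>\<omega>: "\<rho> x = \<rho> 1 * \<omega> x" for x
    using pure_dominated[OF \<omega> \<rho> dom] .
  have inv': "\<rho> 1 * \<omega> (q * y) = \<omega> y" for y
    by (rule trans[OF \<rho>\<omega>[symmetric] inv])
  from inv'[of 1] have "\<rho> 1 * \<omega> q = 1" by (simp add: \<omega>O)
  then have "\<omega> (q * y) = \<omega> q * \<omega> y" for y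
    using inv'[of y] by (metis mult.assoc mult.commute mult.left_neutral)
  then show ?thesis by (simp add: factors_def)
qed

lemma factors_mult: "factors \<omega> a \<Longrightarrow> factors \<omega> b \<Longrightarrow> factors \<omega> (a * b)"
  by (simp add: factors_def mult.assoc)

lemma factors_scale: "\<omega> \<in> Om \<Longrightarrow> factors \<omega> a \<Longrightarrow> factors \<omega> (z *\<^sub>C a)"
  by (simp add: factors_def mult_scaleC_left om_scale)

lemma factors_add: "\<omega> \<in> Om \<Longrightarrow> factors \<omega> a \<Longrightarrow> factors \<omega> b \<Longrightarrow> factors \<omega> (a + b)"
  by (simp add: factors_def distrib_right om_add algebra_simps)

lemma pure_factors_dominant:
  assumes \<omega>: "\<omega> \<in> pure_states le \<Omega>" and r: "r \<in> Q"
  shows "factors \<omega> r"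
proof -
  have "factors \<omega> (prod_list qs)" if "set qs \<subseteq> Q'" for qs
    using that
  proof (induction qs)
    case Nil
    show ?case by (simp add: factors_def pure_state_om(2)[OF \<omega>])
  next
    case (Cons q qs)
    then show ?case by (simp add: factors_mult pure_factors_gen[OF \<omega>])
  qed
  then show ?thesis
    using r factors_scale[OF pure_state_om(1)[OF \<omega>]] unfolding constructed_dominant_set_def by blast
qed

text \<open>
  As \<open>\<omega>\<close> is already multiplicative on the dominant set, \<open>a \<le> r\<^sup>2\<close> with \<open>r \<in> Q\<close> shows that
  \<open>x \<mapsto> \<omega> (a * x)\<close> is dominated by \<open>\<omega>(r)\<^sup>2 \<omega>\<close>. Both this domination and positivity of the
  functional use that products of positive elements are positive.
\<close>

lemma pure_factors_down:
  assumes \<omega>: "\<omega> \<in> pure_states le \<Omega>" and a: "a \<in> D"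
  shows "factors \<omega> a"
proof -
  note \<omega>O = pure_state_om[OF \<omega>]
  obtain r where r: "r \<in> Q" "r * r - a \<in> Pos"
    using down_le_square[OF a] .
  have rf: "\<omega> (r * y) = \<omega> r * \<omega> y" for y
    using pure_factors_dominant[OF \<omega> r(1)] by (simp add: factors_def)
  have "r\<^sup>\<star> = r"
    using dominant_facts[OF r(1)] by (simp add: square_coercive_def)
  then have r_real: "\<omega> r = of_real (Re (\<omega> r))"
    using om_herm_real[OF \<omega>O(1)] by (simp add: complex_eq_iff)
  define \<rho> where "\<rho> = biact a \<omega> 1"
  have \<rho>_apply: "\<rho> x = \<omega> (a * x)" for x
    by (simp add: \<rho>_def biact_def comm)
  have \<rho>\<Omega>: "\<rho> \<in> \<Omega>"
    unfolding \<rho>_def using \<omega>O Omega_biact by blast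
  have "\<rho> \<in> dual_pos le"
  proof (rule dual_posI)
    show "\<rho> \<in> dual" using \<rho>\<Omega> Omega_dual by blast
    show "\<rho> (x\<^sup>\<star>) = cnj (\<rho> x)" for x
      using om_star[OF \<omega>O(1), of "a * x"] Pos_star[of a] a by (simp add: \<rho>_apply star_mult_comm)
    show "0 \<le> Re (\<rho> x)" if "x \<in> Pos" for x
      unfolding \<rho>_apply using that a by (intro om_Re_pos[OF \<omega>O(1)] Pos_mult) auto
  qed
  with \<rho>\<Omega> have "\<rho> \<in> Om" by blast
  moreover have "Re (\<rho> x) \<le> (Re (\<omega> r))\<^sup>2 * Re (\<omega> x)" if "x \<in> Pos" for x
  proof -
    have "(r * r - a) * x \<in> Pos" using r that by (intro Pos_mult)
    from om_Re_pos[OF \<omega>O(1) this] have "Re (\<rho> x) \<le> Re (\<omega> (r * (r * x)))"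
      by (simp add: \<rho>_apply left_diff_distrib om_diff[OF \<omega>O(1)] mult.assoc)
    also have "\<omega> (r * (r * x)) = of_real ((Re (\<omega> r))\<^sup>2) * \<omega> x"
      using r_real rf by (simp add: power2_eq_square)
    finally show ?thesis by simp
  qed
  ultimately have "\<rho> x = \<rho> 1 * \<omega> x" for x
    by (rule pure_dominated[OF \<omega>])
  then show ?thesis
    by (simp add: factors_def \<rho>_apply)
qed

lemma pure_factors_Pos:
  assumes \<omega>: "\<omega> \<in> pure_states le \<Omega>" and a: "a \<in> Pos"
  shows "factors \<omega> a"
  unfolding factors_def
proof
  fix x
  note \<omega>O = pure_state_om[OF \<omega>]
  define B where "B = snorm \<omega> x + snorm \<omega> 1 * cmod (\<omega> x) + 1"
  have B: "0 < B" using snorm_nonneg[OF \<omega>O(1)] by (simp add: B_def add_nonneg_pos)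
  have "cmod (\<omega> (a * x) - \<omega> a * \<omega> x) \<le> 0"
  proof (rule field_le_epsilon)
    fix d :: real assume d: "0 < d"
    obtain y where y: "y \<in> D" "snorm \<omega> (y - a) < d / B"
      using strong_approx[OF a \<omega>O(1)] d B by (metis divide_pos_pos)
    have "\<omega> (y * x) = \<omega> y * \<omega> x"
      using pure_factors_down[OF \<omega> y(1)] by (simp add: factors_def)
    then have "\<omega> (a * x) - \<omega> a * \<omega> x = \<omega> ((y - a) * 1) * \<omega> x - \<omega> ((y - a) * x)"
      by (simp add: left_diff_distrib om_diff[OF \<omega>O(1)])
    also have "cmod \<dots> \<le> cmod (\<omega> ((y - a) * 1)) * cmod (\<omega> x) + cmod (\<omega> ((y - a) * x))"
      by (metis norm_mult norm_triangle_ineq4)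
    also have "\<dots> \<le> snorm \<omega> (y - a) * snorm \<omega> 1 * cmod (\<omega> x) + snorm \<omega> (y - a) * snorm \<omega> x"
      by (intro add_mono mult_right_mono cauchy_schwarz_mult[OF \<omega>O(1)]) auto
    also have "\<dots> \<le> snorm \<omega> (y - a) * B"
      using snorm_nonneg[OF \<omega>O(1), of "y - a"] by (simp add: B_def algebra_simps)
    also have "\<dots> \<le> d"
      using y(2) B by (simp add: pos_less_divide_eq less_imp_le)
    finally show "cmod (\<omega> (a * x) - \<omega> a * \<omega> x) \<le> 0 + d" by simp
  qed
  then show "\<omega> (a * x) = \<omega> a * \<omega> x" by simp
qed

lemma pure_is_character:
  assumes \<omega>: "\<omega> \<in> pure_states le \<Omega>" shows "\<omega> \<in> characters le \<Omega>"
proof -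
  note \<omega>O = pure_state_om[OF \<omega>]
  note clo = factors_add[OF \<omega>O(1)] factors_scale[OF \<omega>O(1)] pure_factors_Pos[OF \<omega>]
  have herm: "factors \<omega> a" if a: "a\<^sup>\<star> = a" for a
  proof -
    have "factors \<omega> ((1 / 4) *\<^sub>C ((a + 1) * (a + 1)) + (- 1 / 4) *\<^sub>C ((a - 1) * (a - 1)))"
      using a by (intro clo Pos_square) (simp_all add: star_add star_diff)
    moreover have "(1 / 4) *\<^sub>C ((a + 1) * (a + 1)) + (- 1 / 4) *\<^sub>C ((a - 1) * (a - 1)) = a"
    proof -
      have "(a + 1) * (a + 1) = (a - 1) * (a - 1) + 4 *\<^sub>C a"
      proof -
        have "(4 :: complex) = 1 + 1 + 1 + 1" by simp
        then have "4 *\<^sub>C a = a + a + a + a"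
          by (simp only: scaleC_add_left scaleC_one)
        then show ?thesis by (simp add: algebra_simps)
      qed
      then show ?thesis
        by (simp add: scaleC_add_right scaleC_scaleC scaleC_one)
    qed
    ultimately show ?thesis by simp
  qed
  have "factors \<omega> a" for a
  proof -
    \<comment> \<open>The imaginary part of \<open>a\<close>, up to the factor \<open>2\<close>.\<close>
    define b where "b = \<i> *\<^sub>C (a\<^sup>\<star> - a)"
    have "factors \<omega> ((1 / 2) *\<^sub>C (a + a\<^sup>\<star>) + (\<i> / 2) *\<^sub>C b)"
      by (intro clo herm) (simp_all add: b_def star_add star_star star_scaleC star_diff add.commute
          scaleC.scale_right_diff_distrib)
    moreover have "(1 / 2) *\<^sub>C (a + a\<^sup>\<star>) + (\<i> / 2) *\<^sub>C b = a"
      by (simp add: b_def scaleC_scaleC scaleC_add_right scaleC.scale_right_diff_distrib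
          scaleC_add_left[symmetric] scaleC_one)
    ultimately show ?thesis by simp
  qed
  then show ?thesis
    using \<omega>O by (simp add: characters_def factors_def)
qed

end

theorem theorem5p17:
  fixes le :: "'a::complex_star_algebra \<Rightarrow> 'a \<Rightarrow> bool"
    and \<Omega> :: "('a \<Rightarrow> complex) set"
  assumes "abstract_Ostar_algebra le \<Omega>"
    and "\<forall>a b :: 'a. a * b = b * a"
    and "downwards_closed le \<Omega>"
    and "sufficiently_many_stieltjes_states le \<Omega>"
  shows "pure_states le \<Omega> = characters le \<Omega>"
proof -
  obtain Q' where Q': "Q' \<noteq> {}" "\<forall>q \<in> Q'. coercive le q"
    "\<forall>\<omega> \<in> states le \<Omega>. \<forall>q \<in> Q'. stieltjes_state le \<Omega> q \<omega>"
    "pos_elems le \<subseteq> strong_topology le \<Omega> closure_of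
            (down_algebra le (constructed_dominant_set Q') \<inter> pos_elems le)"
    using assms(4) unfolding sufficiently_many_stieltjes_states_def by blast
  interpret abstract_Ostar_algebra le \<Omega> by (rule assms(1))
  interpret commutative_stieltjes_Ostar le \<Omega> Q'
    using assms Q' by unfold_locales auto
  show ?thesis
    using pure_is_character character_is_pure by blast
qed

end
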